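(* Suppose $r,t,s,\delta\in\mathbb R$ are such that $2s+t\ge r$, $\delta\ge 0$ and $s>0$. Let $f\in H^{r+\delta}(\mathbb T^2)$ and let $g$ denote elements of $H^t(\mathbb T^2\times Q)$. Then the regularized reconstruction operator $P^s_\alpha I^*$ gives a regularization strategy in the sense that $$\lim_{\varepsilon\to0}\ \sup_{\|g\|_{H^t(\mathbb T^2\times Q)}\le\varepsilon}\left\|P^s_{\alpha(\varepsilon)}I^*(If+g)-f\right\|_{H^r(\mathbb T^2)}=0,\qquad \alpha(\varepsilon)=\sqrt{\varepsilon}.$$ Moreover, if $\|g\|_{H^t(\mathbb T^2\times Q)}\le\varepsilon$, $0<\delta<2s$ and $0<\alpha\le \frac{2s}{\delta}-1$, then $$\left\|P^s_\alpha I^*(If+g)-f\right\|_{H^r(\mathbb T^2)}\le \alpha^{\delta/(2s)}\,C\!\left(\tfrac{\delta}{2s}\right)\|f\|_{H^{r+\delta}(\mathbb T^2)}+\frac{\varepsilon}{\alpha},$$ where $C(x)=x(x^{-1}-1)^{1-x}$.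
   Context: $\mathbb T^2=\mathbb R^2/\mathbb Z^2$, and $\mathcal T'$ is the space of distributions on $\mathbb T^2$ (dual of $C^\infty(\mathbb T^2)$), with Fourier coefficients $\hat f(k)=f(e^{-2\pi i k\cdot x})$, $k\in\mathbb Z^2$. Write $\langle k\rangle=(1+|k|^2)^{1/2}$. For $\tau\in\mathbb R$, $H^\tau(\mathbb T^2)$ is the space of $f\in\mathcal T'$ with finite norm $\|f\|^2_{H^\tau(\mathbb T^2)}=\sum_{k\in\mathbb Z^2}\langle k\rangle^{2\tau}|\hat f(k)|^2$. Fix $Q\subset\mathbb Z^2\setminus\{0\}$ such that every nonzero $v\in\mathbb Z^2$ is an integer multiple of a unique element of $Q$. For $\tau\in\mathbb R$, $H^\tau(\mathbb T^2\times Q)$ is the set of $g$ on $\mathbb T^2\times Q$ such that $g(\cdot,v)\in H^\tau(\mathbb T^2)$ for every $v\in Q$, the average (zeroth Fourier coefficient) of $g(\cdot,v)$ over $\mathbb T^2$ is the same for all $v\in Q$ (denoted $\hat g(0,0)$), and the norm $$\|g\|^2_{H^\tau(\mathbb T^2\times Q)}=|\hat g(0,0)|^2+\sum_{k\in\mathbb Z^2\setminus 0}\sum_{v\in Q}\langle k\rangle^{2\tau}|\hat g(k,v)|^2$$ is finite, where $\hat g(k,v)$ is the $k$-th Fourier coefficient of $g(\cdot,v)$. The X-ray transform is $If(x,v)=\int_0^1 f(x+tv)\,dt$ for continuous $f$, extended to $f\in\mathcal T'$ for each fixed $v$ by duality, using that $If(\cdot,v)$ is formally $L^2(\mathbb T^2)$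 self-adjoint; equivalently $\widehat{If}(k,v)=\hat f(k)$ if $k\cdot v=0$ and $\widehat{If}(k,v)=0$ otherwise. $I^*$ is the Hilbert space adjoint of $I:H^\tau(\mathbb T^2)\to H^\tau(\mathbb T^2\times Q)$; it is given by the same formula for every $\tau\in\mathbb R$, namely $\widehat{I^*g}(0)=\hat g(0,0)$ and $\widehat{I^*g}(k)=\hat g(k,v_k)$ for $k\ne0$, where $v_k$ is the unique element of $Q$ orthogonal to $k$, so $I^*(If+g)$ is unambiguous. For $\alpha>0$, $P^s_\alpha$ is the Fourier multiplier with symbol $(1+\alpha\langle k\rangle^{2s})^{-1}$, i.e. $\widehat{P^s_\alpha f}(k)=(1+\alpha\langle k\rangle^{2s})^{-1}\hat f(k)$. *)

theory Defs
  imports "HOL-Analysis.Analysis"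
begin

section \<open>Test functions and distributions on the torus\<close>

text \<open>
  The frequency lattice is the type \<^typ>\<open>int \<times> int\<close>, the plane is \<^typ>\<open>real \<times> real\<close> (with its
  Euclidean inner product and norm), and functions on the torus are functions on the plane that
  are invariant under integer translations.
\<close>

definition lat :: "int \<times> int \<Rightarrow> real \<times> real" where
  "lat k = (of_int (fst k), of_int (snd k))"

definition japanese :: "int \<times> int \<Rightarrow> real" where
  "japanese k = sqrt (1 + (norm (lat k))\<^sup>2)"

definition dderiv :: "real \<times> real \<Rightarrow> (real \<times> real \<Rightarrow> complex) \<Rightarrow> real \<times> real \<Rightarrow> complex" where
  "dderiv u \<phi> = (\<lambda>x. frechet_derivative \<phi> (at x) u)"

primrec Ck :: "nat \<Rightarrow> (real \<times> real \<Rightarrow> complex) \<Rightarrow> bool" where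
  "Ck 0 \<phi> \<longleftrightarrow> continuous_on UNIV \<phi>"
| "Ck (Suc n) \<phi> \<longleftrightarrow> (\<forall>x. \<phi> differentiable (at x)) \<and> (\<forall>u. Ck n (dderiv u \<phi>))"

definition test_funs :: "(real \<times> real \<Rightarrow> complex) set" where
  "test_funs = {\<phi>. (\<forall>n. Ck n \<phi>) \<and> (\<forall>x k. \<phi> (x + lat k) = \<phi> x)}"

definition pderiv2 :: "nat \<Rightarrow> nat \<Rightarrow> (real \<times> real \<Rightarrow> complex) \<Rightarrow> real \<times> real \<Rightarrow> complex" where
  "pderiv2 a b \<phi> = (dderiv (1, 0) ^^ a) ((dderiv (0, 1) ^^ b) \<phi>)"

definition test_seminorm :: "nat \<Rightarrow> (real \<times> real \<Rightarrow> complex) \<Rightarrow> real" where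
  "test_seminorm N \<phi> = (\<Sum>(a, b)\<in>{(a, b). a + b \<le> N}. SUP x. norm (pderiv2 a b \<phi> x))"

text \<open>
  Distributions are the linear functionals on the test functions that are continuous for the
  Frechet topology given by the seminorms above.  A functional is made total by the value
  \<^term>\<open>0\<close> outside the test functions, so that equality of distributions is equality of functions.
\<close>

type_synonym functional = "(real \<times> real \<Rightarrow> complex) \<Rightarrow> complex"

definition distributions :: "functional set" where
  "distributions = {f.
     (\<forall>\<phi>\<in>test_funs. \<forall>\<psi>\<in>test_funs. f (\<lambda>x. \<phi> x + \<psi> x) = f \<phi> + f \<psi>) \<and>
     (\<forall>\<phi>\<in>test_funs. \<forall>c. f (\<lambda>x. c * \<phi> x) = c * f \<phi>) \<and>
     (\<exists>C N. \<forall>\<phi>\<in>test_funs. norm (f \<phi>) \<le> C * test_seminorm N \<phi>) \<and>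
     (\<forall>\<phi>. \<phi> \<notin> test_funs \<longrightarrow> f \<phi> = 0)}"

definition fourier :: "functional \<Rightarrow> int \<times> int \<Rightarrow> complex" where
  "fourier f k = f (\<lambda>x. exp (- (2 * of_real pi * \<i> * of_real (lat k \<bullet> x))))"


section \<open>Sobolev spaces\<close>

definition H :: "real \<Rightarrow> functional set" where
  "H \<tau> = {f \<in> distributions.
      (\<lambda>k. japanese k powr (2 * \<tau>) * (norm (fourier f k))\<^sup>2) summable_on UNIV}"

definition H_norm :: "real \<Rightarrow> functional \<Rightarrow> real" where
  "H_norm \<tau> f = sqrt (\<Sum>\<^sub>\<infinity>k. japanese k powr (2 * \<tau>) * (norm (fourier f k))\<^sup>2)"

definition H_inner :: "real \<Rightarrow> functional \<Rightarrow> functional \<Rightarrow> complex" where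
  "H_inner \<tau> f h =
     (\<Sum>\<^sub>\<infinity>k. of_real (japanese k powr (2 * \<tau>)) * fourier f k * cnj (fourier h k))"

definition direction_set :: "(int \<times> int) set \<Rightarrow> bool" where
  "direction_set Q \<longleftrightarrow> 0 \<notin> Q \<and>
     (\<forall>v. v \<noteq> 0 \<longrightarrow> (\<exists>!q. q \<in> Q \<and> (\<exists>n. v = (n * fst q, n * snd q))))"

text \<open>
  An element of the Sobolev space over \<open>T\<^sup>2 \<times> Q\<close> is a family of distributions indexed by lattice
  vectors; only its values at the directions in \<open>Q\<close> matter.
\<close>

definition mean_HQ :: "(int \<times> int) set \<Rightarrow> (int \<times> int \<Rightarrow> functional) \<Rightarrow> complex" where
  "mean_HQ Q g = (THE c. \<forall>v\<in>Q. fourier (g v) 0 = c)"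

definition HQ :: "(int \<times> int) set \<Rightarrow> real \<Rightarrow> (int \<times> int \<Rightarrow> functional) set" where
  "HQ Q \<tau> = {g. (\<forall>v\<in>Q. g v \<in> H \<tau>) \<and> (\<exists>c. \<forall>v\<in>Q. fourier (g v) 0 = c) \<and>
      (\<lambda>(k, v). japanese k powr (2 * \<tau>) * (norm (fourier (g v) k))\<^sup>2) summable_on (- {0}) \<times> Q}"

definition HQ_norm :: "(int \<times> int) set \<Rightarrow> real \<Rightarrow> (int \<times> int \<Rightarrow> functional) \<Rightarrow> real" where
  "HQ_norm Q \<tau> g = sqrt ((norm (mean_HQ Q g))\<^sup>2 +
     (\<Sum>\<^sub>\<infinity>(k, v)\<in>(- {0}) \<times> Q. japanese k powr (2 * \<tau>) * (norm (fourier (g v) k))\<^sup>2))"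

definition HQ_inner :: "(int \<times> int) set \<Rightarrow> real \<Rightarrow>
    (int \<times> int \<Rightarrow> functional) \<Rightarrow> (int \<times> int \<Rightarrow> functional) \<Rightarrow> complex" where
  "HQ_inner Q \<tau> g h = mean_HQ Q g * cnj (mean_HQ Q h) +
     (\<Sum>\<^sub>\<infinity>(k, v)\<in>(- {0}) \<times> Q.
        of_real (japanese k powr (2 * \<tau>)) * fourier (g v) k * cnj (fourier (h v) k))"


section \<open>The X-ray transform, its adjoint and the regularizing multiplier\<close>

definition xray_fun :: "(real \<times> real \<Rightarrow> complex) \<Rightarrow> int \<times> int \<Rightarrow> real \<times> real \<Rightarrow> complex" where
  "xray_fun \<phi> v x = integral {0..1} (\<lambda>t. \<phi> (x + t *\<^sub>R lat v))"

text \<open>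
  On distributions the transform in a fixed direction is defined by duality: on functions it is
  symmetric for the bilinear pairing (integral of the product over the torus), as one sees from
  the substitution of \<open>1 - t\<close> for \<open>t\<close> and periodicity.
\<close>

definition xray :: "functional \<Rightarrow> int \<times> int \<Rightarrow> functional" where
  "xray f v = (\<lambda>\<phi>. if \<phi> \<in> test_funs then f (xray_fun \<phi> v) else 0)"

text \<open>
  The Hilbert space adjoint of the X-ray transform from \<open>H \<tau>\<close> to \<open>HQ Q \<tau>\<close>.  Its value is the same
  for all \<open>\<tau>\<close> with \<open>g \<in> HQ Q \<tau>\<close>, so that the quantifier over \<open>\<tau>\<close> and the choice are harmless: the
  distribution with the required property exists and is unique.
\<close>

definition xray_adjoint :: "(int \<times> int) set \<Rightarrow> (int \<times> int \<Rightarrow> functional) \<Rightarrow> functional" where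
  "xray_adjoint Q g = (SOME h. \<exists>\<tau>. g \<in> HQ Q \<tau> \<and> h \<in> H \<tau> \<and>
     (\<forall>f\<in>H \<tau>. HQ_inner Q \<tau> (xray f) g = H_inner \<tau> f h))"

text \<open>
  Here, too, the chosen distribution is unique, as a distribution on the torus is determined by its
  Fourier coefficients.
\<close>

definition reg_mult :: "real \<Rightarrow> real \<Rightarrow> functional \<Rightarrow> functional" where
  "reg_mult s \<alpha> f = (SOME u. u \<in> distributions \<and>
     (\<forall>k. fourier u k = of_real (inverse (1 + \<alpha> * japanese k powr (2 * s))) * fourier f k))"

definition recon_error :: "(int \<times> int) set \<Rightarrow> real \<Rightarrow> real \<Rightarrow> functional \<Rightarrow>
    (int \<times> int \<Rightarrow> functional) \<Rightarrow> functional" where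
  "recon_error Q s \<alpha> f g =
     (\<lambda>\<phi>. reg_mult s \<alpha> (xray_adjoint Q (\<lambda>v \<psi>. xray f v \<psi> + g v \<psi>)) \<phi> - f \<phi>)"

definition C_const :: "real \<Rightarrow> real" where
  "C_const x = x * (inverse x - 1) powr (1 - x)"

end

theory Submission
  imports Defs
begin

text \<open>
  Everything happens on the side of Fourier coefficients.  The X-ray transform keeps the coefficient
  of \<open>f\<close> at \<open>k\<close> exactly in the direction of \<open>Q\<close> orthogonal to \<open>k\<close>, and there is one such
  direction for each \<open>k \<noteq> 0\<close>; the adjoint reads this coefficient back.  Hence the reconstruction
  from \<open>I f + g\<close> has the coefficients \<open>m k * (f k + b k)\<close>, where \<open>m k = 1 / (1 + \<alpha> \<langle>k\<rangle>\<^bsup>2s\<^esup>)\<close> is the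
  regularizing symbol, with \<open>\<langle>k\<rangle> = japanese k\<close>, and \<open>b\<close> are the coefficients of the adjoint
  applied to the noise \<open>g\<close> (\<open>recon_error\<close>).

  The error \<open>(m k - 1) * f k + m k * b k\<close> is the sum of a bias and of filtered noise, which Minkowski's
  inequality separates.  The adjoint has norm at most one (\<open>adj_coef_l2\<close>) and \<open>m k \<le> \<langle>k\<rangle>\<^bsup>-2s\<^esup> / \<alpha>\<close>, so the
  noise contributes at most \<open>\<epsilon> / \<alpha>\<close> when \<open>r \<le> 2 s + t\<close> (\<open>recon_error_bound\<close>).  If \<open>f\<close> has \<open>\<delta>\<close> more
  derivatives than the error norm sees, with \<open>0 < \<delta> < 2 s\<close>, then \<open>(1 - m k) \<langle>k\<rangle>\<^bsup>-\<delta>\<^esup>\<close> is a power of \<open>\<alpha>\<close> times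
  \<open>y powr (1 - x) / (1 + y)\<close> with \<open>y = \<alpha> \<langle>k\<rangle>\<^bsup>2s\<^esup>\<close> and \<open>x = \<delta> / (2 s)\<close>; the maximum of this
  function is the constant of the theorem (\<open>bias_le\<close>).  Without a rate, the bias tends to zero by
  dominated convergence (\<open>bias_tendsto_0\<close>), and \<open>\<alpha> = sqrt \<epsilon>\<close> makes the noise term \<open>sqrt \<epsilon>\<close>.

  The analytic work lies in connecting this with actual distributions.  The transform of a
  distribution must be a distribution, which needs differentiation under the integral
  (\<open>xray_distribution\<close>).  The adjoint and the multiplier are given by choice, so distributions with
  prescribed coefficients must exist; they are built from the rapid decay of the Fourier coefficients
  of test functions (\<open>distribution_with_fourier\<close>).
\<close>

text \<open>
  Points and frequencies are handled as single vectors throughout, so the simplifier should not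
  replace a quantified vector by its two coordinates.
\<close>

declare split_paired_All [simp del] split_paired_all [simp del] split_paired_Ex [simp del]

section \<open>Calculus of test functions\<close>

lemma dderiv_eqI:
  assumes "(\<phi> has_derivative D) (at x)"
  shows "dderiv u \<phi> x = D u"
  using frechet_derivative_at[OF assms] by (simp add: dderiv_def)

lemma has_derivative_dderiv:
  assumes "\<phi> differentiable (at x)"
  shows "(\<phi> has_derivative (\<lambda>u. dderiv u \<phi> x)) (at x)"
  using assms frechet_derivative_works[of \<phi> "at x"] by (simp add: dderiv_def)

lemma Ck_imp_continuous: "Ck n \<phi> \<Longrightarrow> continuous_on UNIV \<phi>"
  by (cases n) (auto simp: continuous_on_eq_continuous_at differentiable_imp_continuous_within)

lemma dderiv_add:
  assumes "\<phi> differentiable (at x)" "\<psi> differentiable (at x)"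
  shows "dderiv u (\<lambda>x. \<phi> x + \<psi> x) x = dderiv u \<phi> x + dderiv u \<psi> x"
  by (rule dderiv_eqI[OF has_derivative_add[OF assms[THEN has_derivative_dderiv]]])

lemma dderiv_mult_left:
  assumes "\<phi> differentiable (at x)"
  shows "dderiv u (\<lambda>x. c * \<phi> x) x = c * dderiv u \<phi> x"
  by (rule dderiv_eqI[OF has_derivative_mult_right[OF has_derivative_dderiv[OF assms]]])

lemma Ck_add: "Ck n \<phi> \<Longrightarrow> Ck n \<psi> \<Longrightarrow> Ck n (\<lambda>x. \<phi> x + \<psi> x)"
proof (induction n arbitrary: \<phi> \<psi>)
  case 0
  then show ?case by (auto intro!: continuous_intros)
next
  case (Suc n)
  have "dderiv u (\<lambda>x. \<phi> x + \<psi> x) = (\<lambda>x. dderiv u \<phi> x + dderiv u \<psi> x)" for u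
    using Suc.prems by (intro ext dderiv_add) auto
  then show ?case using Suc by auto
qed

lemma Ck_mult_left: "Ck n \<phi> \<Longrightarrow> Ck n (\<lambda>x. c * \<phi> x)"
proof (induction n arbitrary: \<phi>)
  case 0
  then show ?case by (auto intro!: continuous_intros)
next
  case (Suc n)
  have "dderiv u (\<lambda>x. c * \<phi> x) = (\<lambda>x. c * dderiv u \<phi> x)" for u
    using Suc.prems by (intro ext dderiv_mult_left) auto
  then show ?case using Suc by auto
qed

lemma test_funs_add: "\<phi> \<in> test_funs \<Longrightarrow> \<psi> \<in> test_funs \<Longrightarrow> (\<lambda>x. \<phi> x + \<psi> x) \<in> test_funs"
  by (auto simp: test_funs_def Ck_add)

lemma test_funs_mult_left: "\<phi> \<in> test_funs \<Longrightarrow> (\<lambda>x. c * \<phi> x) \<in> test_funs"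
  by (auto simp: test_funs_def Ck_mult_left)

lemma test_funs_differentiable: "\<phi> \<in> test_funs \<Longrightarrow> \<phi> differentiable (at x)"
  unfolding test_funs_def using Ck.simps(2) by blast

lemma test_funs_continuous: "\<phi> \<in> test_funs \<Longrightarrow> continuous_on A \<phi>"
  unfolding test_funs_def using Ck_imp_continuous continuous_on_subset by blast

lemma test_funs_periodic: "\<phi> \<in> test_funs \<Longrightarrow> \<phi> (x + lat k) = \<phi> x"
  by (simp add: test_funs_def)

lemma dderiv_test_funs:
  assumes "\<phi> \<in> test_funs"
  shows "dderiv u \<phi> \<in> test_funs"
proof -
  have "Ck n (dderiv u \<phi>)" for n
    using assms Ck.simps(2)[of n \<phi>] by (auto simp: test_funs_def simp del: Ck.simps)
  moreover have "dderiv u \<phi> (x + lat k) = dderiv u \<phi> x" for x k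
  proof -
    have "(\<phi> has_derivative (\<lambda>u. dderiv u \<phi> (x + lat k))) (at (x + lat k))"
      by (rule has_derivative_dderiv[OF test_funs_differentiable[OF assms]])
    then have "((\<lambda>y. \<phi> (y + lat k)) has_derivative (\<lambda>u. dderiv u \<phi> (x + lat k))) (at x)"
      by (auto intro!: has_derivative_eq_rhs[OF has_derivative_compose[where g = \<phi>, of "\<lambda>y. y + lat k"]]
          derivative_eq_intros)
    then have "(\<phi> has_derivative (\<lambda>u. dderiv u \<phi> (x + lat k))) (at x)"
      by (simp add: test_funs_periodic[OF assms])
    then show ?thesis by (simp add: dderiv_eqI)
  qed
  ultimately show ?thesis by (simp add: test_funs_def)
qed

lemma pderiv2_test_funs: "\<phi> \<in> test_funs \<Longrightarrow> pderiv2 a b \<phi> \<in> test_funs"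
proof -
  have "(dderiv u ^^ n) \<phi> \<in> test_funs" if "\<phi> \<in> test_funs" for u n \<phi>
    using that by (induction n) (auto intro: dderiv_test_funs)
  then show "\<phi> \<in> test_funs \<Longrightarrow> pderiv2 a b \<phi> \<in> test_funs"
    by (simp add: pderiv2_def)
qed

text \<open>
  A periodic function takes all its values on the unit square, which is compact.  This makes the
  suprema in \<^const>\<open>test_seminorm\<close> genuine least upper bounds.
\<close>

lemma test_funs_bounded:
  assumes "\<phi> \<in> test_funs"
  shows "bdd_above (range (\<lambda>x. norm (\<phi> x)))"
proof -
  have "compact (\<phi> ` cbox (0, 0) (1, 1))"
    by (intro compact_continuous_image test_funs_continuous assms) auto
  then obtain B where B: "\<And>y. y \<in> cbox (0, 0) (1, 1) \<Longrightarrow> norm (\<phi> y) \<le> B"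
    using compact_imp_bounded bounded_iff by (metis image_eqI)
  have "norm (\<phi> x) \<le> B" for x
  proof -
    have "x = (frac (fst x), frac (snd x)) + lat (\<lfloor>fst x\<rfloor>, \<lfloor>snd x\<rfloor>)"
      by (simp add: lat_def frac_def prod_eq_iff)
    then have "\<phi> x = \<phi> (frac (fst x), frac (snd x))"
      using test_funs_periodic[OF assms] by metis
    then show ?thesis
      using B[of "(frac (fst x), frac (snd x))"] by (simp add: cbox_Pair_eq less_imp_le[OF frac_lt_1])
  qed
  then show ?thesis by (auto intro!: bdd_aboveI)
qed

lemma finite_order_set: "finite {(a, b). a + b \<le> (N::nat)}"
  by (rule finite_subset[of _ "{..N} \<times> {..N}"]) auto

lemma sup_pderiv2_nonneg:
  assumes "\<phi> \<in> test_funs"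
  shows "0 \<le> (SUP x. norm (pderiv2 a b \<phi> x))"
  by (rule cSUP_upper2[where x = 0]) (auto intro: test_funs_bounded[OF pderiv2_test_funs[OF assms]])

lemma norm_pderiv2_le_seminorm:
  assumes "\<phi> \<in> test_funs" "a + b \<le> N"
  shows "norm (pderiv2 a b \<phi> x) \<le> test_seminorm N \<phi>"
proof -
  have "norm (pderiv2 a b \<phi> x) \<le> (SUP x. norm (pderiv2 a b \<phi> x))"
    by (rule cSUP_upper[OF UNIV_I]) (rule test_funs_bounded[OF pderiv2_test_funs[OF assms(1)]])
  also have "\<dots> = (\<lambda>(a, b). SUP x. norm (pderiv2 a b \<phi> x)) (a, b)" by simp
  also have "\<dots> \<le> test_seminorm N \<phi>"
    unfolding test_seminorm_def
    by (rule member_le_sum) (use assms finite_order_set sup_pderiv2_nonneg in auto)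
  finally show ?thesis .
qed

lemma test_seminorm_nonneg: "\<phi> \<in> test_funs \<Longrightarrow> 0 \<le> test_seminorm N \<phi>"
  unfolding test_seminorm_def by (rule sum_nonneg) (auto intro: sup_pderiv2_nonneg)

lemma test_seminorm_mono:
  assumes "\<phi> \<in> test_funs" "N \<le> M"
  shows "test_seminorm N \<phi> \<le> test_seminorm M \<phi>"
  unfolding test_seminorm_def
  by (rule sum_mono2) (use assms finite_order_set sup_pderiv2_nonneg in auto)

section \<open>Exponentials\<close>

text \<open>
  The characters of the torus.  The Fourier coefficient of a distribution at \<open>k\<close> is its value at
  the character of \<open>-k\<close>.
\<close>

definition torus_exp :: "int \<times> int \<Rightarrow> real \<times> real \<Rightarrow> complex" where
  "torus_exp k x = exp (2 * of_real pi * \<i> * of_real (lat k \<bullet> x))"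

lemma lat_minus: "lat (- k) = - lat k" and lat_add: "lat (k + j) = lat k + lat j"
  and lat_zero [simp]: "lat 0 = 0"
  by (auto simp: lat_def zero_prod_def)

lemma fourier_eq: "fourier f k = f (torus_exp (- k))"
  by (simp add: fourier_def torus_exp_def[abs_def] lat_minus)

lemma torus_exp_add: "torus_exp (k + j) x = torus_exp k x * torus_exp j x"
  by (simp add: torus_exp_def lat_add inner_add_left exp_add[symmetric] algebra_simps)

lemma torus_exp_0 [simp]: "torus_exp 0 = (\<lambda>x. 1)"
  by (simp add: torus_exp_def[abs_def])

lemma norm_torus_exp [simp]: "norm (torus_exp k x) = 1"
  by (simp add: torus_exp_def norm_exp_eq_Re)

lemma lat_inner_lat: "lat k \<bullet> lat j = of_int (fst k * fst j + snd k * snd j)"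
  by (simp add: lat_def inner_prod_def)

lemma torus_exp_translate: "torus_exp k (x + y) = torus_exp k x * torus_exp k y"
  by (simp add: torus_exp_def inner_add_right exp_add[symmetric] algebra_simps)

lemma torus_exp_lat [simp]: "torus_exp k (lat j) = 1"
  unfolding torus_exp_def lat_inner_lat exp_eq_1
  by (auto intro!: exI[of _ "fst k * fst j + snd k * snd j"])

lemma has_derivative_torus_exp:
  "(torus_exp k has_derivative (\<lambda>u. 2 * of_real pi * \<i> * of_real (lat k \<bullet> u) * torus_exp k x)) (at x)"
proof -
  have "((\<lambda>x. exp (2 * of_real pi * \<i> * of_real (lat k \<bullet> x))) has_derivative
     (\<lambda>u. exp (2 * of_real pi * \<i> * of_real (lat k \<bullet> x)) * (2 * of_real pi * \<i> * of_real (lat k \<bullet> u)))) (at x)"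
    by (rule has_derivative_eq_rhs[OF has_derivative_compose[where g = exp,
          OF _ DERIV_exp[unfolded has_field_derivative_def]]]) (auto intro!: derivative_eq_intros)
  then show ?thesis
    by (simp add: torus_exp_def[abs_def] mult_ac)
qed

lemma torus_exp_differentiable: "torus_exp k differentiable (at x)"
  unfolding differentiable_def using has_derivative_torus_exp by blast

lemma dderiv_torus_exp:
  "dderiv u (torus_exp k) = (\<lambda>x. 2 * of_real pi * \<i> * of_real (lat k \<bullet> u) * torus_exp k x)"
  by (rule ext) (rule dderiv_eqI[OF has_derivative_torus_exp])

lemma torus_exp_test_funs: "torus_exp k \<in> test_funs"
proof -
  have "continuous_on UNIV (torus_exp k)"
    by (auto simp: torus_exp_def[abs_def] intro!: continuous_intros)
  then have "Ck n (torus_exp k)" for n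
    by (induction n) (auto simp: dderiv_torus_exp torus_exp_differentiable intro: Ck_mult_left)
  then show ?thesis
    by (simp add: test_funs_def torus_exp_translate)
qed

section \<open>The X-ray transform of test functions and distributions\<close>

text \<open>
  Differentiation under the integral sign.  The Leibniz rule asks for a derivative that is
  continuous as a bounded linear map; on the plane this follows from the continuity of each
  directional derivative, which is what \<^const>\<open>Ck\<close> provides.
\<close>

lemma has_derivative_xray_fun:
  assumes "Ck (Suc n) \<phi>"
  shows "(xray_fun \<phi> v has_derivative (\<lambda>u. xray_fun (dderiv u \<phi>) v x)) (at x)"
proof -
  define fx where "fx = (\<lambda>x t. Blinfun (\<lambda>u. dderiv u \<phi> (x + t *\<^sub>R lat v)))"
  have diff: "(\<phi> has_derivative (\<lambda>u. dderiv u \<phi> y)) (at y)" for y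
    using assms by (intro has_derivative_dderiv) simp
  have app: "blinfun_apply (fx x t) = (\<lambda>u. dderiv u \<phi> (x + t *\<^sub>R lat v))" for x t
    unfolding fx_def
    by (rule bounded_linear_Blinfun_apply) (rule has_derivative_bounded_linear[OF diff])
  have cont: "continuous_on UNIV (dderiv u \<phi>)" for u
    using assms by (auto intro: Ck_imp_continuous)
  have contfx: "continuous_on (UNIV \<times> cbox 0 1) (\<lambda>(x, t). fx x t)"
  proof (rule continuous_on_blinfun_componentwise)
    fix i :: "real \<times> real"
    show "continuous_on (UNIV \<times> cbox 0 1) (\<lambda>p. blinfun_apply (case p of (x, t) \<Rightarrow> fx x t) i)"
      by (auto simp: app split_beta intro!: continuous_intros continuous_on_compose2[OF cont])
  qed
  have der: "((\<lambda>x. \<phi> (x + t *\<^sub>R lat v)) has_derivative blinfun_apply (fx x t)) (at x within UNIV)" for x t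
    unfolding app
    by (auto intro!: has_derivative_eq_rhs[OF has_derivative_compose[OF _ diff, of "\<lambda>x. x + t *\<^sub>R lat v"]]
        derivative_eq_intros)
  have cphi: "continuous_on UNIV \<phi>"
    using assms by (rule Ck_imp_continuous)
  have int: "(\<lambda>t. \<phi> (x + t *\<^sub>R lat v)) integrable_on cbox 0 1" for x
    by (intro integrable_continuous continuous_on_compose2[OF cphi] continuous_intros) auto
  have L: "((\<lambda>x. integral (cbox 0 1) (\<lambda>t. \<phi> (x + t *\<^sub>R lat v))) has_derivative
      blinfun_apply (integral (cbox 0 1) (fx x))) (at x within UNIV)"
    by (rule leibniz_rule[OF der int contfx]) auto
  have "continuous_on (cbox 0 1) (\<lambda>t. case (x, t) of (x, t) \<Rightarrow> fx x t)"
    by (rule continuous_on_compose2[OF contfx]) (auto intro!: continuous_intros)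
  then have contfx1: "continuous_on (cbox 0 1) (fx x)" by simp
  have "blinfun_apply (integral (cbox 0 1) (fx x)) = (\<lambda>u. xray_fun (dderiv u \<phi>) v x)"
  proof (rule ext)
    fix u
    have "integral (cbox 0 1) ((\<lambda>B. blinfun_apply B u) \<circ> fx x) = blinfun_apply (integral (cbox 0 1) (fx x)) u"
      by (rule integral_linear[OF integrable_continuous[OF contfx1]]) (rule blinfun.bounded_linear_left)
    then show "blinfun_apply (integral (cbox 0 1) (fx x)) u = xray_fun (dderiv u \<phi>) v x"
      by (simp add: xray_fun_def o_def app)
  qed
  with L show ?thesis
    by (simp add: xray_fun_def[abs_def])
qed

lemma continuous_xray_fun:
  assumes "continuous_on UNIV \<phi>"
  shows "continuous_on UNIV (xray_fun \<phi> v)"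
proof -
  have "continuous_on UNIV (\<lambda>x. integral (cbox 0 1) (\<lambda>t. \<phi> (x + t *\<^sub>R lat v)))"
    by (rule integral_continuous_on_param)
      (auto simp: split_beta intro!: continuous_intros continuous_on_compose2[OF assms])
  then show ?thesis by (simp add: xray_fun_def[abs_def])
qed

lemma Ck_xray_fun: "Ck n \<phi> \<Longrightarrow> Ck n (xray_fun \<phi> v)"
proof (induction n arbitrary: \<phi>)
  case 0
  then show ?case by (simp add: continuous_xray_fun)
next
  case (Suc n)
  note D = has_derivative_xray_fun[OF Suc.prems, of v]
  have "dderiv u (xray_fun \<phi> v) = xray_fun (dderiv u \<phi>) v" for u
    by (rule ext) (rule dderiv_eqI[OF D])
  moreover have "xray_fun \<phi> v differentiable (at x)" for x
    using D unfolding differentiable_def by blast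
  ultimately show ?case
    using Suc by auto
qed

lemma xray_fun_test_funs: 
  assumes "\<phi> \<in> test_funs"
  shows "xray_fun \<phi> v \<in> test_funs"
proof -
  have "xray_fun \<phi> v (x + lat k) = xray_fun \<phi> v x" for x k
  proof -
    have "\<phi> (x + lat k + t *\<^sub>R lat v) = \<phi> (x + t *\<^sub>R lat v)" for t
      using test_funs_periodic[OF assms, of "x + t *\<^sub>R lat v" k] by (simp add: add_ac)
    then show ?thesis by (simp add: xray_fun_def)
  qed
  then show ?thesis
    using assms by (simp add: test_funs_def Ck_xray_fun)
qed

lemma dderiv_xray_fun: 
  assumes "\<phi> \<in> test_funs"
  shows "dderiv u (xray_fun \<phi> v) = xray_fun (dderiv u \<phi>) v"
proof (rule ext)
  fix x
  have "Ck (Suc 0) \<phi>" using assms by (simp only: test_funs_def mem_Collect_eq)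
  then show "dderiv u (xray_fun \<phi> v) x = xray_fun (dderiv u \<phi>) v x"
    by (rule dderiv_eqI[OF has_derivative_xray_fun])
qed

lemma pderiv2_xray_fun:
  assumes "\<phi> \<in> test_funs"
  shows "pderiv2 a b (xray_fun \<phi> v) = xray_fun (pderiv2 a b \<phi>) v"
proof -
  have "(dderiv u ^^ n) (xray_fun \<phi> v) = xray_fun ((dderiv u ^^ n) \<phi>) v \<and> (dderiv u ^^ n) \<phi> \<in> test_funs"
    if "\<phi> \<in> test_funs" for n u \<phi>
    using that by (induction n) (auto simp: dderiv_xray_fun dderiv_test_funs)
  then show ?thesis using assms by (simp add: pderiv2_def)
qed

lemma test_fun_line_integrable:
  assumes "\<phi> \<in> test_funs"
  shows "(\<lambda>t. \<phi> (x + t *\<^sub>R lat v)) integrable_on {0..1}"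
  by (auto intro!: integrable_continuous_interval continuous_intros
      continuous_on_compose2[OF test_funs_continuous[OF assms, of UNIV]])

lemma norm_xray_fun_le:
  assumes "\<phi> \<in> test_funs" "\<And>y. norm (\<phi> y) \<le> B"
  shows "norm (xray_fun \<phi> v x) \<le> B"
proof -
  have "norm (integral {0..1} (\<lambda>t. \<phi> (x + t *\<^sub>R lat v))) \<le> integral {0..1} (\<lambda>t::real. B)"
    by (rule integral_norm_bound_integral) (auto intro: assms test_fun_line_integrable)
  then show ?thesis by (simp add: xray_fun_def)
qed

text \<open>
  An average over a segment commutes with derivatives and does not increase suprema.
\<close>

lemma test_seminorm_xray_fun_le:
  assumes "\<phi> \<in> test_funs"
  shows "test_seminorm N (xray_fun \<phi> v) \<le> test_seminorm N \<phi>"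
proof -
  have "(SUP x. norm (pderiv2 a b (xray_fun \<phi> v) x)) \<le> (SUP x. norm (pderiv2 a b \<phi> x))" for a b
  proof (rule cSUP_least)
    fix x
    show "norm (pderiv2 a b (xray_fun \<phi> v) x) \<le> (SUP x. norm (pderiv2 a b \<phi> x))"
      unfolding pderiv2_xray_fun[OF assms]
      by (intro norm_xray_fun_le pderiv2_test_funs assms cSUP_upper UNIV_I test_funs_bounded)
  qed simp
  then show ?thesis
    unfolding test_seminorm_def by (intro sum_mono) auto
qed

text \<open>
  Continuity of the dual operator on distributions is the seminorm bound for the transform of test
  functions.
\<close>

lemma xray_distribution:
  assumes "f \<in> distributions"
  shows "xray f v \<in> distributions"
proof -
  have 1: "\<forall>\<phi>\<in>test_funs. \<forall>\<psi>\<in>test_funs. xray f v (\<lambda>x. \<phi> x + \<psi> x) = xray f v \<phi> + xray f v \<psi>"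
  proof (intro ballI)
    fix \<phi> \<psi> assume *: "\<phi> \<in> test_funs" "\<psi> \<in> test_funs"
    have "xray_fun (\<lambda>x. \<phi> x + \<psi> x) v = (\<lambda>x. xray_fun \<phi> v x + xray_fun \<psi> v x)"
      by (rule ext) (simp add: xray_fun_def integral_add test_fun_line_integrable *)
    then show "xray f v (\<lambda>x. \<phi> x + \<psi> x) = xray f v \<phi> + xray f v \<psi>"
      using assms * by (simp add: xray_def distributions_def test_funs_add xray_fun_test_funs)
  qed
  have 2: "\<forall>\<phi>\<in>test_funs. \<forall>c. xray f v (\<lambda>x. c * \<phi> x) = c * xray f v \<phi>"
  proof (intro ballI allI)
    fix \<phi> c assume *: "\<phi> \<in> test_funs"
    have "xray_fun (\<lambda>x. c * \<phi> x) v = (\<lambda>x. c * xray_fun \<phi> v x)"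
      by (rule ext) (simp add: xray_fun_def)
    then show "xray f v (\<lambda>x. c * \<phi> x) = c * xray f v \<phi>"
      using assms * by (simp add: xray_def distributions_def test_funs_mult_left xray_fun_test_funs)
  qed
  obtain C N where CN: "\<forall>\<phi>\<in>test_funs. norm (f \<phi>) \<le> C * test_seminorm N \<phi>"
    using assms by (auto simp: distributions_def)
  have 3: "\<forall>\<phi>\<in>test_funs. norm (xray f v \<phi>) \<le> \<bar>C\<bar> * test_seminorm N \<phi>"
  proof
    fix \<phi> assume *: "\<phi> \<in> test_funs"
    have "norm (xray f v \<phi>) \<le> C * test_seminorm N (xray_fun \<phi> v)"
      using CN * by (simp add: xray_def xray_fun_test_funs)
    also have "\<dots> \<le> \<bar>C\<bar> * test_seminorm N (xray_fun \<phi> v)"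
      by (intro mult_right_mono test_seminorm_nonneg xray_fun_test_funs *) auto
    also have "\<dots> \<le> \<bar>C\<bar> * test_seminorm N \<phi>"
      by (intro mult_left_mono test_seminorm_xray_fun_le *) auto
    finally show "norm (xray f v \<phi>) \<le> \<bar>C\<bar> * test_seminorm N \<phi>" .
  qed
  show ?thesis
    unfolding distributions_def using 1 2 3 by (auto simp: xray_def)
qed

text \<open>
  Along the line \<open>x + t v\<close> the character of \<open>k\<close> oscillates with the integer frequency \<open>k \<bullet> v\<close>, so
  its mean over the unit interval vanishes unless that frequency is zero.
\<close>

lemma xray_fun_torus_exp:
  "xray_fun (torus_exp k) v = (\<lambda>x. (if lat k \<bullet> lat v = 0 then 1 else 0) * torus_exp k x)"
proof (rule ext)
  fix x
  define n where "n = fst k * fst v + snd k * snd v"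
  define c where "c = 2 * of_real pi * \<i> * (of_int n :: complex)"
  have line: "torus_exp k (x + t *\<^sub>R lat v) = torus_exp k x * exp (c * of_real t)" for t
    by (simp add: torus_exp_translate)
      (simp add: torus_exp_def c_def lat_inner_lat n_def mult_ac)
  have "integral {0..1} (\<lambda>t. exp (c * of_real t)) = (if n = 0 then 1 else 0)"
  proof (cases "n = 0")
    case True
    then show ?thesis by (simp add: c_def)
  next
    case False
    then have c0: "c \<noteq> 0" by (simp add: c_def)
    have "((\<lambda>t. exp (c * of_real t)) has_integral exp (c * of_real 1) / c - exp (c * of_real 0) / c) {0..1}"
    proof (rule fundamental_theorem_of_calculus)
      fix t :: real
      have "((\<lambda>z. exp (c * z) / c) has_field_derivative exp (c * of_real t)) (at (of_real t))"
        using c0 by (auto intro!: derivative_eq_intros)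
      then show "((\<lambda>t. exp (c * of_real t) / c) has_vector_derivative exp (c * of_real t)) (at t within {0..1})"
        by (rule has_vector_derivative_real_field)
    qed simp
    moreover have "exp (c * of_real 1) = 1"
      by (auto simp: c_def exp_eq_1 intro!: exI[of _ n])
    ultimately show ?thesis using False by (simp add: integral_unique)
  qed
  then show "xray_fun (torus_exp k) v x = (if lat k \<bullet> lat v = 0 then 1 else 0) * torus_exp k x"
    by (simp add: xray_fun_def line lat_inner_lat n_def[symmetric] del: of_int_add of_int_mult)
qed

lemma fourier_xray:
  assumes "f \<in> distributions"
  shows "fourier (xray f v) k = (if lat k \<bullet> lat v = 0 then fourier f k else 0)"
  using assms torus_exp_test_funs[of "- k"]
  by (auto simp: fourier_eq xray_def xray_fun_torus_exp lat_minus distributions_def)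

section \<open>Fourier coefficients of test functions\<close>

lemma Ck_SucD: "Ck (Suc n) \<phi> \<Longrightarrow> Ck n \<phi>"
proof (induction n arbitrary: \<phi>)
  case 0
  then show ?case using Ck_imp_continuous[OF 0] by simp
next
  case (Suc n)
  then show ?case by (metis Ck.simps(2))
qed

lemma dderiv_mult:
  assumes "\<phi> differentiable (at x)" "\<psi> differentiable (at x)"
  shows "dderiv u (\<lambda>x. \<phi> x * \<psi> x) x = \<phi> x * dderiv u \<psi> x + dderiv u \<phi> x * \<psi> x"
  by (rule dderiv_eqI[OF has_derivative_mult[OF assms[THEN has_derivative_dderiv]]])

lemma Ck_mult: "Ck n \<phi> \<Longrightarrow> Ck n \<psi> \<Longrightarrow> Ck n (\<lambda>x. \<phi> x * \<psi> x)"
proof (induction n arbitrary: \<phi> \<psi>)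
  case 0
  then show ?case by (auto intro!: continuous_intros)
next
  case (Suc n)
  have "dderiv u (\<lambda>x. \<phi> x * \<psi> x) = (\<lambda>x. \<phi> x * dderiv u \<psi> x + dderiv u \<phi> x * \<psi> x)" for u
    using Suc.prems by (intro ext dderiv_mult) auto
  moreover have "Ck n \<phi>" "Ck n \<psi>" using Suc.prems Ck_SucD by blast+
  ultimately show ?case using Suc by (auto intro!: Ck_add)
qed

lemma test_funs_mult: "\<phi> \<in> test_funs \<Longrightarrow> \<psi> \<in> test_funs \<Longrightarrow> (\<lambda>x. \<phi> x * \<psi> x) \<in> test_funs"
  by (auto simp: test_funs_def Ck_mult)

text \<open>
  Over a period the fundamental theorem of calculus leaves no boundary term.  The direction must be
  a lattice vector for the segment to close up on the torus.
\<close>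

lemma integral_dderiv_line:
  assumes "\<psi> \<in> test_funs"
  shows "integral (cbox 0 1) (\<lambda>t. dderiv (lat j) \<psi> (x + t *\<^sub>R lat j)) = 0"
proof -
  have "((\<lambda>t. dderiv (lat j) \<psi> (x + t *\<^sub>R lat j)) has_integral
      \<psi> (x + 1 *\<^sub>R lat j) - \<psi> (x + 0 *\<^sub>R lat j)) {0..1}"
  proof (rule fundamental_theorem_of_calculus)
    fix t :: real
    have D: "(\<psi> has_derivative (\<lambda>u. dderiv u \<psi> (x + t *\<^sub>R lat j))) (at (x + t *\<^sub>R lat j))"
      by (rule has_derivative_dderiv[OF test_funs_differentiable[OF assms]])
    have "((\<lambda>t. \<psi> (x + t *\<^sub>R lat j)) has_derivative
        (\<lambda>h. dderiv (h *\<^sub>R lat j) \<psi> (x + t *\<^sub>R lat j))) (at t within {0..1})"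
      by (rule has_derivative_compose[of "\<lambda>t. x + t *\<^sub>R lat j" _ _ _ \<psi>, OF _ D])
        (auto intro!: derivative_eq_intros)
    then show "((\<lambda>t. \<psi> (x + t *\<^sub>R lat j)) has_vector_derivative
        dderiv (lat j) \<psi> (x + t *\<^sub>R lat j)) (at t within {0..1})"
      using linear_scale[OF has_derivative_linear[OF D]] by (simp add: has_vector_derivative_def)
  qed simp
  then show ?thesis
    using test_funs_periodic[OF assms] by (simp add: integral_unique)
qed

lemma integral_dderiv_torus:
  assumes \<psi>: "\<psi> \<in> test_funs" and u: "u \<in> {(1, 0), (0, 1)}"
  shows "integral (cbox (0, 0) (1, 1)) (dderiv u \<psi>) = 0"
proof -
  have cont: "continuous_on (cbox (0, 0) (1, 1)) (dderiv u \<psi>)"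
    by (intro test_funs_continuous dderiv_test_funs \<psi>)
  have cont': "continuous_on (cbox (0, 0) (1, 1)) (\<lambda>(x, y). dderiv u \<psi> (x, y))"
    using cont by simp
  have I: "integral (cbox (0, 0) (1, 1)) (dderiv u \<psi>)
      = integral (cbox 0 1) (\<lambda>x. integral (cbox 0 1) (\<lambda>y. dderiv u \<psi> (x, y)))"
    by (rule integral_prod_continuous[OF cont])
  from u consider "u = lat (1, 0)" | "u = lat (0, 1)" by (auto simp: lat_def)
  then show ?thesis
  proof cases
    case 1
    have "integral (cbox 0 1) (\<lambda>x. dderiv u \<psi> (x, y)) = 0" for y
      using integral_dderiv_line[OF \<psi>, of "(1, 0)" "(0, y)"] by (simp add: 1) (simp add: lat_def)
    then show ?thesis
      unfolding I integral_swap_continuous[OF cont'] by simp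
  next
    case 2
    have "integral (cbox 0 1) (\<lambda>y. dderiv u \<psi> (x, y)) = 0" for x
      using integral_dderiv_line[OF \<psi>, of "(0, 1)" "(x, 0)"] by (simp add: 2) (simp add: lat_def)
    then show ?thesis unfolding I by simp
  qed
qed

text \<open>
  The coefficient of the character of \<open>-k\<close> in the expansion of a test function.  The sign is the
  one that pairs with \<^const>\<open>fourier\<close>: a distribution \<open>h\<close> should act by summing
  \<open>fourier h k * coef k \<phi>\<close> over \<open>k\<close>.
\<close>

definition coef :: "int \<times> int \<Rightarrow> (real \<times> real \<Rightarrow> complex) \<Rightarrow> complex" where
  "coef k \<phi> = integral (cbox (0, 0) (1, 1)) (\<lambda>x. torus_exp k x * \<phi> x)"

lemma test_funs_integrable: "\<phi> \<in> test_funs \<Longrightarrow> \<phi> integrable_on cbox (0, 0) (1, 1)"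
  by (intro integrable_continuous test_funs_continuous)

lemma coef_add:
  assumes "\<phi> \<in> test_funs" "\<psi> \<in> test_funs"
  shows "coef k (\<lambda>x. \<phi> x + \<psi> x) = coef k \<phi> + coef k \<psi>"
  unfolding coef_def distrib_left
  by (intro integral_add test_funs_integrable test_funs_mult torus_exp_test_funs assms)

lemma coef_mult_left: "coef k (\<lambda>x. c * \<phi> x) = c * coef k \<phi>"
  unfolding coef_def mult.left_commute[of _ c] by simp

lemma norm_coef_le:
  assumes "\<phi> \<in> test_funs" "\<And>x. norm (\<phi> x) \<le> B"
  shows "norm (coef k \<phi>) \<le> B"
proof -
  have "norm (coef k \<phi>) \<le> integral (cbox (0, 0) (1, 1)) (\<lambda>x::real \<times> real. B)"
    unfolding coef_def
    by (intro integral_norm_bound_integral test_funs_integrable test_funs_mult torus_exp_test_funs assms)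
      (auto simp: norm_mult assms)
  then show ?thesis by (simp add: content_Pair)
qed

text \<open>
  Integration by parts: the derivative of the product of \<open>\<phi>\<close> with a character has integral zero.
\<close>

lemma coef_dderiv:
  assumes "\<phi> \<in> test_funs" "u \<in> {(1, 0), (0, 1)}"
  shows "coef k (dderiv u \<phi>) = - (2 * of_real pi * \<i> * of_real (lat k \<bullet> u)) * coef k \<phi>"
proof -
  let ?c = "2 * of_real pi * \<i> * of_real (lat k \<bullet> u) :: complex"
  have "0 = integral (cbox (0, 0) (1, 1)) (dderiv u (\<lambda>x. torus_exp k x * \<phi> x))"
    by (rule integral_dderiv_torus[symmetric])
      (use assms in \<open>auto intro!: test_funs_mult torus_exp_test_funs\<close>)
  also have "dderiv u (\<lambda>x. torus_exp k x * \<phi> x)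
      = (\<lambda>x. torus_exp k x * dderiv u \<phi> x + ?c * (torus_exp k x * \<phi> x))"
    by (rule ext) (simp add: dderiv_mult dderiv_torus_exp torus_exp_differentiable
        test_funs_differentiable assms)
  also have "integral (cbox (0, 0) (1, 1)) \<dots> = coef k (dderiv u \<phi>) + ?c * coef k \<phi>"
    unfolding coef_def
    by (subst integral_add) (auto intro!: test_funs_integrable test_funs_mult test_funs_mult_left
        torus_exp_test_funs dderiv_test_funs assms)
  finally show ?thesis by (simp add: eq_neg_iff_add_eq_0)
qed

lemma coef_torus_exp: "coef k (torus_exp (- j)) = (if k = j then 1 else 0)"
proof -
  have prod: "(\<lambda>x. torus_exp k x * torus_exp (- j) x) = torus_exp (k - j)"
    by (rule ext) (simp add: torus_exp_add[symmetric])
  show ?thesis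
  proof (cases "k = j")
    case True
    then show ?thesis unfolding coef_def prod by (simp add: content_Pair)
  next
    case False
    then have "fst (k - j) \<noteq> 0 \<or> snd (k - j) \<noteq> 0" by (auto simp: prod_eq_iff)
    then obtain u :: "real \<times> real" where u: "u \<in> {(1, 0), (0, 1)}" "lat (k - j) \<bullet> u \<noteq> 0"
      by (force simp: lat_def)
    have "2 * of_real pi * \<i> * of_real (lat (k - j) \<bullet> u)
        * integral (cbox (0, 0) (1, 1)) (torus_exp (k - j)) = 0"
      using integral_dderiv_torus[OF torus_exp_test_funs u(1), of "k - j"]
      by (simp add: dderiv_torus_exp)
    then have "integral (cbox (0, 0) (1, 1)) (torus_exp (k - j)) = 0"
      using u(2) by simp
    then show ?thesis using False by (simp add: coef_def prod)
  qed
qed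

lemma coef_dderiv_funpow:
  assumes "\<phi> \<in> test_funs" "u \<in> {(1, 0), (0, 1)}"
  shows "coef k ((dderiv u ^^ n) \<phi>) = (- (2 * of_real pi * \<i> * of_real (lat k \<bullet> u))) ^ n * coef k \<phi>
    \<and> (dderiv u ^^ n) \<phi> \<in> test_funs"
proof (induction n)
  case (Suc n)
  then show ?case
    using coef_dderiv[of "(dderiv u ^^ n) \<phi>" u k] assms by (auto simp: dderiv_test_funs)
qed (use assms in auto)

lemma coef_decay_directional:
  assumes "\<phi> \<in> test_funs" "u \<in> {(1, 0), (0, 1)}" "n \<le> N"
  shows "\<bar>lat k \<bullet> u\<bar> ^ n * norm (coef k \<phi>) \<le> test_seminorm N \<phi>"
proof -
  have "(dderiv u ^^ n) \<phi> = pderiv2 n 0 \<phi> \<or> (dderiv u ^^ n) \<phi> = pderiv2 0 n \<phi>"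
    using assms(2) by (auto simp: pderiv2_def)
  then have "norm ((dderiv u ^^ n) \<phi> x) \<le> test_seminorm N \<phi>" for x
    using norm_pderiv2_le_seminorm[OF assms(1), of n 0 N x]
      norm_pderiv2_le_seminorm[OF assms(1), of 0 n N x] assms(3) by auto
  then have "norm (coef k ((dderiv u ^^ n) \<phi>)) \<le> test_seminorm N \<phi>"
    using coef_dderiv_funpow[OF assms(1,2)] by (intro norm_coef_le) auto
  also have "norm (coef k ((dderiv u ^^ n) \<phi>)) = (2 * pi * \<bar>lat k \<bullet> u\<bar>) ^ n * norm (coef k \<phi>)"
    using coef_dderiv_funpow[OF assms(1,2), of k n] by (simp add: norm_mult norm_power)
  finally have *: "(2 * pi * \<bar>lat k \<bullet> u\<bar>) ^ n * norm (coef k \<phi>) \<le> test_seminorm N \<phi>" .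
  have "1 * \<bar>lat k \<bullet> u\<bar> \<le> 2 * pi * \<bar>lat k \<bullet> u\<bar>"
    using pi_gt3 by (intro mult_right_mono) auto
  then have "\<bar>lat k \<bullet> u\<bar> ^ n \<le> (2 * pi * \<bar>lat k \<bullet> u\<bar>) ^ n"
    by (intro power_mono) auto
  then show ?thesis
    using * by (meson mult_right_mono norm_ge_zero order_trans)
qed

lemma japanese_sq: "(japanese k)\<^sup>2 = 1 + (of_int (fst k))\<^sup>2 + (of_int (snd k))\<^sup>2"
  by (simp add: japanese_def lat_def norm_Pair)

lemma japanese_ge_1: "1 \<le> japanese k"
  by (simp add: japanese_def)

lemma japanese_pos: "0 < japanese k" 
  using japanese_ge_1[of k] by linarith

lemma japanese_0 [simp]: "japanese 0 = 1"
  by (simp add: japanese_def)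

text \<open>
  The square \<open>1 + a\<^sup>2 + b\<^sup>2\<close> of the weight is at most three times its largest summand, so decay
  along the two coordinate axes is enough.
\<close>

lemma coef_decay:
  assumes "\<phi> \<in> test_funs"
  shows "japanese k ^ (2 * m) * norm (coef k \<phi>) \<le> 3 ^ m * test_seminorm (2 * m) \<phi>"
proof -
  define a b :: real where "a = of_int (fst k)" and "b = of_int (snd k)"
  define M where "M = max 1 (max (a\<^sup>2) (b\<^sup>2))"
  have "(japanese k)\<^sup>2 \<le> 3 * M"
    unfolding japanese_sq by (simp add: M_def a_def b_def)
  then have "((japanese k)\<^sup>2) ^ m \<le> (3 * M) ^ m"
    by (rule power_mono) simp
  then have 1: "japanese k ^ (2 * m) * norm (coef k \<phi>) \<le> (3 * M) ^ m * norm (coef k \<phi>)"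
    unfolding power_mult[symmetric] by (rule mult_right_mono) simp
  have dir: "\<bar>a\<bar> ^ (2 * m) * norm (coef k \<phi>) \<le> test_seminorm (2 * m) \<phi>"
     "\<bar>b\<bar> ^ (2 * m) * norm (coef k \<phi>) \<le> test_seminorm (2 * m) \<phi>"
     "norm (coef k \<phi>) \<le> test_seminorm (2 * m) \<phi>"
    using coef_decay_directional[OF assms, of "(1, 0)" "2 * m" "2 * m" k]
      coef_decay_directional[OF assms, of "(0, 1)" "2 * m" "2 * m" k]
      coef_decay_directional[OF assms, of "(0, 1)" 0 "2 * m" k]
    by (simp_all add: lat_def a_def b_def)
  have "M = 1 \<or> M = a\<^sup>2 \<or> M = b\<^sup>2" by (auto simp: M_def max_def)
  then have "M ^ m * norm (coef k \<phi>) \<le> test_seminorm (2 * m) \<phi>"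
    using dir by (auto simp: power_mult)
  then show ?thesis
    using 1 by (simp add: power_mult_distrib mult.assoc) (smt (verit) mult_left_mono zero_le_power)
qed

lemma summable_on_inverse_square_int: "(\<lambda>n::int. inverse (1 + (of_int n)\<^sup>2) :: real) summable_on UNIV"
proof -
  have "summable (\<lambda>n::nat. inverse (1 + (of_nat n)\<^sup>2) :: real)"
  proof (rule summable_comparison_test)
    show "\<exists>N. \<forall>n\<ge>N. norm (inverse (1 + (of_nat n)\<^sup>2) :: real) \<le> inverse ((of_nat n) ^ 2)"
      by (rule exI[of _ 1]) (auto intro!: le_imp_inverse_le)
    show "summable (\<lambda>n::nat. inverse ((of_nat n) ^ 2) :: real)"
      by (rule inverse_power_summable) simp
  qed
  then have nat: "(\<lambda>n::nat. inverse (1 + (of_nat n)\<^sup>2) :: real) summable_on UNIV"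
    by (subst summable_on_UNIV_nonneg_real_iff) (auto simp: add_nonneg_nonneg)
  have "(\<lambda>n::int. inverse (1 + (of_int n)\<^sup>2) :: real) summable_on range int"
    by (subst summable_on_reindex) (use nat in \<open>auto simp: o_def\<close>)
  moreover have "(\<lambda>n::int. inverse (1 + (of_int n)\<^sup>2) :: real) summable_on range (\<lambda>n. - int n)"
    by (subst summable_on_reindex) (use nat in \<open>auto simp: o_def inj_on_def\<close>)
  moreover have "range int \<union> range (\<lambda>n. - int n) = UNIV"
    by (auto intro: int_cases2)
  ultimately show ?thesis
    using summable_on_union by metis
qed

text \<open>
  The fourth power of the weight dominates \<open>(1 + a\<^sup>2) * (1 + b\<^sup>2)\<close>, which turns the sum over the
  plane lattice into a product of two sums over the integers.
\<close>

lemma summable_on_japanese: "(\<lambda>k. inverse (japanese k ^ 4)) summable_on UNIV"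
proof -
  define s where "s = (\<lambda>n::int. inverse (1 + (of_int n)\<^sup>2) :: real)"
  have s0: "s n \<ge> 0" for n by (simp add: s_def)
  have "(\<lambda>(a, b). s a * s b) summable_on (UNIV \<times> UNIV)"
  proof (rule summable_on_SigmaI)
    show "((\<lambda>y. case (x, y) of (a, b) \<Rightarrow> s a * s b) has_sum s x * infsum s UNIV) UNIV" for x
      using summable_on_inverse_square_int by (auto simp: s_def intro!: has_sum_cmult_right)
    show "(\<lambda>x. s x * infsum s UNIV) summable_on UNIV"
      using summable_on_inverse_square_int by (intro summable_on_cmult_left) (simp add: s_def)
  qed (use s0 in auto)
  then have "(\<lambda>(a, b). s a * s b) summable_on UNIV" by simp
  then show ?thesis
  proof (rule summable_on_comparison_test)
    fix k :: "int \<times> int"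
    define a b :: real where "a = of_int (fst k)" and "b = of_int (snd k)"
    have "japanese k ^ 4 = (1 + a\<^sup>2 + b\<^sup>2)\<^sup>2"
      by (simp add: a_def b_def flip: japanese_sq)
    moreover have "(1 + a\<^sup>2) * (1 + b\<^sup>2) \<le> (1 + a\<^sup>2 + b\<^sup>2) * (1 + a\<^sup>2 + b\<^sup>2)"
      by (intro mult_mono) auto
    ultimately have "inverse (japanese k ^ 4) \<le> inverse ((1 + a\<^sup>2) * (1 + b\<^sup>2))"
      by (intro le_imp_inverse_le) (auto simp: power2_eq_square[of "1 + a\<^sup>2 + b\<^sup>2"] add_pos_nonneg)
    then show "inverse (japanese k ^ 4) \<le> (case k of (a, b) \<Rightarrow> s a * s b)"
      by (simp add: s_def a_def b_def split_beta)
  qed (use japanese_pos in \<open>auto simp: less_imp_le\<close>)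
qed

section \<open>Distributions with prescribed Fourier coefficients\<close>

text \<open>
  Every polynomially bounded family is the family of Fourier coefficients of a distribution, which
  is written down as a series: the rapid decay of the coefficients of test functions beats the
  growth of \<open>a\<close> with a factor \<open>japanese k ^ (-4)\<close> to spare, and this factor is
  summable.  Existence here is what makes the choices in \<^const>\<open>xray_adjoint\<close> and
  \<^const>\<open>reg_mult\<close> meaningful.
\<close>

lemma distribution_with_fourier:
  assumes a: "\<And>k. norm (a k) \<le> A * japanese k powr M"
  obtains h where "h \<in> distributions" "\<And>k. fourier h k = a k"
proof -
  \<comment> \<open>Four orders of decay beyond \<open>M\<close> leave the summable weight \<open>japanese k ^ (-4)\<close>.\<close>
  obtain m :: nat where m: "(M + 4) / 2 \<le> of_nat m" using real_arch_simple by blast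
  have A: "A \<ge> 0" 
    using order_trans[OF norm_ge_zero a[of 0]] by simp
  define N where "N = 2 * m"
  have bound: "norm (a k * coef k \<phi>) \<le> A * 3 ^ m * test_seminorm N \<phi> * inverse (japanese k ^ 4)"
    if \<phi>: "\<phi> \<in> test_funs" for k \<phi>
  proof -
    let ?j = "japanese k"
    have "?j powr M * ?j ^ 4 = ?j powr (M + 4)"
      using japanese_pos[of k] by (simp add: powr_add powr_realpow flip: powr_numeral)
    also have "\<dots> \<le> ?j powr (of_nat N)"
      using m japanese_ge_1[of k] by (intro powr_mono) (auto simp: N_def)
    also have "\<dots> = ?j ^ N" using japanese_pos[of k] by (simp add: powr_realpow)
    finally have j: "?j powr M * ?j ^ 4 \<le> ?j ^ N" .
    have "norm (a k * coef k \<phi>) * ?j ^ 4 \<le> A * ?j powr M * norm (coef k \<phi>) * ?j ^ 4"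
      unfolding norm_mult using a[of k] japanese_pos[of k] by (intro mult_right_mono) auto
    also have "\<dots> = A * (norm (coef k \<phi>) * (?j powr M * ?j ^ 4))" by (simp add: mult_ac)
    also have "\<dots> \<le> A * (norm (coef k \<phi>) * ?j ^ N)"
      using j A by (intro mult_left_mono) auto
    also have "\<dots> \<le> A * (3 ^ m * test_seminorm N \<phi>)"
      using coef_decay[OF \<phi>, of k m] A by (intro mult_left_mono) (auto simp: N_def mult_ac)
    finally show ?thesis
      using japanese_pos[of k] by (simp add: field_simps)
  qed
  have abs: "(\<lambda>k. norm (a k * coef k \<phi>)) summable_on UNIV" if "\<phi> \<in> test_funs" for \<phi>
    by (rule summable_on_comparison_test[OF summable_on_cmult_right[OF summable_on_japanese]])
      (use bound[OF that] in auto)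
  have summ: "(\<lambda>k. a k * coef k \<phi>) summable_on UNIV" if "\<phi> \<in> test_funs" for \<phi>
    by (rule Infinite_Sum.abs_summable_summable[OF abs[OF that]])
  define h where "h = (\<lambda>\<phi>. if \<phi> \<in> test_funs then \<Sum>\<^sub>\<infinity>k. a k * coef k \<phi> else 0)"
  define W where "W = (\<Sum>\<^sub>\<infinity>k. inverse (japanese k ^ 4))"
  have "norm (h \<phi>) \<le> (A * 3 ^ m * W) * test_seminorm N \<phi>" if \<phi>: "\<phi> \<in> test_funs" for \<phi>
  proof -
    have "norm (h \<phi>) \<le> (\<Sum>\<^sub>\<infinity>k. norm (a k * coef k \<phi>))"
      using \<phi> abs[OF \<phi>] by (simp add: h_def norm_infsum_bound)
    also have "\<dots> \<le> (\<Sum>\<^sub>\<infinity>k. A * 3 ^ m * test_seminorm N \<phi> * inverse (japanese k ^ 4))"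
      by (intro infsum_mono abs[OF \<phi>] summable_on_cmult_right[OF summable_on_japanese] bound[OF \<phi>])
    also have "\<dots> = A * 3 ^ m * test_seminorm N \<phi> * W"
      unfolding W_def by (rule infsum_cmult_right) (simp add: summable_on_japanese)
    finally show ?thesis by (simp add: mult_ac)
  qed
  moreover have "h (\<lambda>x. \<phi> x + \<psi> x) = h \<phi> + h \<psi>" if "\<phi> \<in> test_funs" "\<psi> \<in> test_funs" for \<phi> \<psi>
    using that by (simp add: h_def test_funs_add coef_add distrib_left infsum_add summ)
  moreover have "h (\<lambda>x. c * \<phi> x) = c * h \<phi>" if "\<phi> \<in> test_funs" for \<phi> c
    using that
    by (simp add: h_def test_funs_mult_left coef_mult_left mult.left_commute[of _ c] infsum_cmult_right summ)
  ultimately have "h \<in> distributions"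
    unfolding distributions_def by (auto simp: h_def)
  moreover have "fourier h j = a j" for j
  proof -
    have "fourier h j = (\<Sum>\<^sub>\<infinity>k. a k * (if k = j then 1 else 0))"
      by (simp add: fourier_eq h_def torus_exp_test_funs coef_torus_exp)
    also have "\<dots> = (\<Sum>\<^sub>\<infinity>k\<in>{j}. a k * (if k = j then 1 else 0))"
      by (rule infsum_cong_neutral) auto
    finally show ?thesis by simp
  qed
  ultimately show thesis by (rule that)
qed

section \<open>Sobolev spaces through Fourier coefficients\<close>

lemma distributions_add_mult:
  assumes f: "f \<in> distributions" and h: "h \<in> distributions"
  shows "(\<lambda>\<phi>. f \<phi> + c * h \<phi>) \<in> distributions"
proof -
  obtain C N where CN: "\<forall>\<phi>\<in>test_funs. norm (f \<phi>) \<le> C * test_seminorm N \<phi>"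
    using f by (auto simp: distributions_def)
  obtain D M where DM: "\<forall>\<phi>\<in>test_funs. norm (h \<phi>) \<le> D * test_seminorm M \<phi>"
    using h by (auto simp: distributions_def)
  have "norm (f \<phi> + c * h \<phi>) \<le> (\<bar>C\<bar> + norm c * \<bar>D\<bar>) * test_seminorm (max N M) \<phi>"
    if \<phi>: "\<phi> \<in> test_funs" for \<phi>
  proof -
    let ?S = "test_seminorm (max N M) \<phi>"
    have "C * test_seminorm N \<phi> \<le> \<bar>C\<bar> * ?S"
      by (intro mult_mono test_seminorm_mono \<phi> test_seminorm_nonneg) auto
    then have 1: "norm (f \<phi>) \<le> \<bar>C\<bar> * ?S" using CN \<phi> by force
    have "D * test_seminorm M \<phi> \<le> \<bar>D\<bar> * ?S"
      by (intro mult_mono test_seminorm_mono \<phi> test_seminorm_nonneg) auto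
    then have 2: "norm (h \<phi>) \<le> \<bar>D\<bar> * ?S" using DM \<phi> by force
    have "norm (f \<phi> + c * h \<phi>) \<le> norm (f \<phi>) + norm c * norm (h \<phi>)"
      using norm_triangle_ineq[of "f \<phi>" "c * h \<phi>"] by (simp add: norm_mult)
    also have "\<dots> \<le> \<bar>C\<bar> * ?S + norm c * (\<bar>D\<bar> * ?S)"
      by (intro add_mono 1 mult_left_mono[OF 2]) simp
    finally show ?thesis by (simp add: algebra_simps)
  qed
  then have "\<exists>C N. \<forall>\<phi>\<in>test_funs. norm (f \<phi> + c * h \<phi>) \<le> C * test_seminorm N \<phi>"
    by blast
  moreover have "f (\<lambda>x. \<phi> x + \<psi> x) + c * h (\<lambda>x. \<phi> x + \<psi> x) = f \<phi> + c * h \<phi> + (f \<psi> + c * h \<psi>)"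
    if "\<phi> \<in> test_funs" "\<psi> \<in> test_funs" for \<phi> \<psi>
    using f h that by (simp add: distributions_def distrib_left)
  moreover have "f (\<lambda>x. b * \<phi> x) + c * h (\<lambda>x. b * \<phi> x) = b * (f \<phi> + c * h \<phi>)"
    if "\<phi> \<in> test_funs" for \<phi> b
    using f h that by (simp add: distributions_def algebra_simps)
  moreover have "f \<phi> + c * h \<phi> = 0" if "\<phi> \<notin> test_funs" for \<phi>
    using f h that by (simp add: distributions_def)
  ultimately show ?thesis
    unfolding distributions_def mem_Collect_eq by blast
qed

lemma fourier_add_mult: "fourier (\<lambda>\<phi>. f \<phi> + c * h \<phi>) k = fourier f k + c * fourier h k"
  by (simp add: fourier_def)

lemma japanese_powr_pos: "0 < japanese k powr \<tau>"
  using japanese_pos[of k] by simp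

lemma weight_sq: "japanese k powr (2 * \<tau>) * (norm z)\<^sup>2 = (japanese k powr \<tau> * norm z)\<^sup>2"
  unfolding power_mult_distrib power2_eq_square[of "japanese k powr \<tau>"] mult_2 powr_add ..

lemma summable_weight_mono:
  assumes "\<sigma> \<le> \<tau>" "(\<lambda>k. japanese (i k) powr (2 * \<tau>) * (norm (a k))\<^sup>2) summable_on S"
  shows "(\<lambda>k. japanese (i k) powr (2 * \<sigma>) * (norm (a k))\<^sup>2) summable_on S"
  by (rule summable_on_comparison_test[OF assms(2)])
    (use assms(1) in \<open>auto intro!: mult_right_mono powr_mono simp: japanese_ge_1\<close>)

lemma summable_weight_add:
  assumes "(\<lambda>k. w k * (norm (a k))\<^sup>2) summable_on S" "(\<lambda>k. w k * (norm (b k))\<^sup>2) summable_on S"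
    "\<And>k. 0 \<le> (w k :: real)"
  shows "(\<lambda>k. w k * (norm (a k + b k))\<^sup>2) summable_on S"
proof (rule summable_on_comparison_test)
  show "(\<lambda>k. 2 * (w k * (norm (a k))\<^sup>2 + w k * (norm (b k))\<^sup>2)) summable_on S"
    by (intro summable_on_cmult_right summable_on_add assms)
  fix k
  have "(norm (a k + b k))\<^sup>2 \<le> (norm (a k) + norm (b k))\<^sup>2"
    by (intro power_mono norm_triangle_ineq) simp
  also have "\<dots> \<le> 2 * ((norm (a k))\<^sup>2 + (norm (b k))\<^sup>2)"
    using sum_squares_bound[of "norm (a k)" "norm (b k)"] by (simp add: power2_sum)
  finally have "w k * (norm (a k + b k))\<^sup>2 \<le> w k * (2 * ((norm (a k))\<^sup>2 + (norm (b k))\<^sup>2))"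
    using assms(3) by (intro mult_left_mono)
  then show "w k * (norm (a k + b k))\<^sup>2 \<le> 2 * (w k * (norm (a k))\<^sup>2 + w k * (norm (b k))\<^sup>2)"
    by (simp add: algebra_simps)
qed (use assms(3) in auto)

lemma H_mono: "\<sigma> \<le> \<tau> \<Longrightarrow> f \<in> H \<tau> \<Longrightarrow> f \<in> H \<sigma>"
  using summable_weight_mono[of \<sigma> \<tau> "\<lambda>k. k" "fourier f" UNIV] by (simp add: H_def)

lemma H_distribution: "f \<in> H \<tau> \<Longrightarrow> f \<in> distributions"
  by (simp add: H_def)

text \<open>
  One term of a convergent series of squares is at most the sum; hence square summable families are
  polynomially bounded and \<open>distribution_with_fourier\<close> applies to them.
\<close>

lemma weighted_l2_bounded:
  assumes "(\<lambda>k. japanese k powr (2 * \<tau>) * (norm (a k))\<^sup>2) summable_on UNIV"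
  obtains A where "\<And>k. norm (a k) \<le> A * japanese k powr (- \<tau>)"
proof
  fix k
  let ?S = "\<Sum>\<^sub>\<infinity>k. japanese k powr (2 * \<tau>) * (norm (a k))\<^sup>2"
  have "(japanese k powr \<tau> * norm (a k))\<^sup>2 \<le> ?S"
    using finite_sum_le_infsum[OF assms, of "{k}"] by (simp add: weight_sq)
  then have "japanese k powr \<tau> * norm (a k) \<le> sqrt ?S"
    by (rule real_le_rsqrt)
  then show "norm (a k) \<le> sqrt ?S * japanese k powr (- \<tau>)"
    using japanese_powr_pos[of k \<tau>] by (simp add: powr_minus field_simps)
qed

lemma H_with_fourier:
  assumes "(\<lambda>k. japanese k powr (2 * \<tau>) * (norm (a k))\<^sup>2) summable_on UNIV"
  obtains h where "h \<in> H \<tau>" "\<And>k. fourier h k = a k"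
proof -
  obtain A where "\<And>k. norm (a k) \<le> A * japanese k powr (- \<tau>)"
    using weighted_l2_bounded[OF assms] by blast
  then obtain h where h: "h \<in> distributions" "\<And>k. fourier h k = a k"
    using distribution_with_fourier by blast
  then have "h \<in> H \<tau>"
    using assms by (simp add: H_def)
  then show thesis using h that by blast
qed

lemma summable_weighted_product:
  assumes "(\<lambda>k. japanese k powr (2 * \<tau>) * (norm (a k))\<^sup>2) summable_on UNIV"
    "(\<lambda>k. japanese k powr (2 * \<tau>) * (norm (b k))\<^sup>2) summable_on UNIV"
  shows "(\<lambda>k. of_real (japanese k powr (2 * \<tau>)) * a k * cnj (b k)) summable_on S"
proof -
  have "(\<lambda>k. norm (of_real (japanese k powr (2 * \<tau>)) * a k * cnj (b k))) summable_on UNIV"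
  proof (rule summable_on_comparison_test[OF summable_on_add[OF assms]])
    fix k
    have "norm (a k) * norm (b k) \<le> (norm (a k))\<^sup>2 + (norm (b k))\<^sup>2"
      using sum_squares_bound[of "norm (a k)" "norm (b k)"]
        mult_nonneg_nonneg[OF norm_ge_zero[of "a k"] norm_ge_zero[of "b k"]] by linarith
    then have "japanese k powr (2 * \<tau>) * (norm (a k) * norm (b k))
        \<le> japanese k powr (2 * \<tau>) * ((norm (a k))\<^sup>2 + (norm (b k))\<^sup>2)"
      by (intro mult_left_mono) auto
    then show "norm (of_real (japanese k powr (2 * \<tau>)) * a k * cnj (b k))
        \<le> japanese k powr (2 * \<tau>) * (norm (a k))\<^sup>2 + japanese k powr (2 * \<tau>) * (norm (b k))\<^sup>2"
      by (simp add: norm_mult algebra_simps)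
  qed auto
  then show ?thesis
    by (rule summable_on_subset[OF Infinite_Sum.abs_summable_summable subset_UNIV])
qed

section \<open>The direction orthogonal to a frequency\<close>

text \<open>
  The rotated vector \<open>w = (-k\<^sub>2, k\<^sub>1)\<close> is orthogonal to \<open>k\<close> and a multiple of some element of \<open>Q\<close>.
  Two elements of \<open>Q\<close> orthogonal to \<open>k\<close> are both parallel to \<open>w\<close>, hence have a common nonzero
  integer multiple, and the uniqueness in \<^const>\<open>direction_set\<close> identifies them.
\<close>

lemma orthogonal_direction:
  assumes Q: "direction_set Q" and k: "k \<noteq> 0"
  shows "\<exists>!v. v \<in> Q \<and> lat k \<bullet> lat v = 0"
proof -
  have orth: "lat k \<bullet> lat v = 0 \<longleftrightarrow> fst k * fst v + snd k * snd v = 0" for v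
    unfolding lat_inner_lat by (simp only: of_int_eq_0_iff)
  define w where "w = (- snd k, fst k)"
  have w0: "w \<noteq> 0" using k by (auto simp: w_def prod_eq_iff)
  obtain q n where q: "q \<in> Q" and w: "w = (n * fst q, n * snd q)"
    using Q w0 unfolding direction_set_def by blast
  have n0: "n \<noteq> 0" using w w0 by (auto simp: zero_prod_def)
  have "n * (fst k * fst q + snd k * snd q) = fst k * fst w + snd k * snd w"
    by (simp add: w algebra_simps)
  also have "\<dots> = 0" by (simp add: w_def)
  finally have qk: "fst k * fst q + snd k * snd q = 0" using n0 by simp
  have "v = q" if v: "v \<in> Q" "fst k * fst v + snd k * snd v = 0" for v
  proof -
    have v0: "v \<noteq> 0" using v Q by (auto simp: direction_set_def)
    \<comment> \<open>\<open>k \<bullet> v = 0\<close> is the cross product relation between \<open>v\<close> and \<open>w\<close>; a nonzero coordinate of \<open>k\<close> serves as the factor \<open>a\<close>.\<close>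
    obtain a b where ab: "a \<noteq> 0" "a * fst v = b * fst w" "a * snd v = b * snd w"
    proof (cases "fst k = 0")
      case True
      then show thesis using k v(2) by (intro that[of "snd k" "- fst v"]) (auto simp: w_def prod_eq_iff)
    next
      case False
      then show thesis using v(2) by (intro that[of "fst k" "snd v"]) (auto simp: w_def algebra_simps)
    qed
    let ?x = "(a * fst v, a * snd v)"
    have "?x \<noteq> 0" using ab(1) v0 by (auto simp: prod_eq_iff)
    moreover have "?x = ((b * n) * fst q, (b * n) * snd q)" using ab w by simp
    ultimately show "v = q"
      using Q v(1) q unfolding direction_set_def by blast
  qed
  then show ?thesis unfolding orth using q qk by blast
qed

definition orth_dir :: "(int \<times> int) set \<Rightarrow> int \<times> int \<Rightarrow> int \<times> int" where
  "orth_dir Q k = (THE v. v \<in> Q \<and> lat k \<bullet> lat v = 0)"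

lemma orth_dir:
  assumes "direction_set Q" "k \<noteq> 0"
  shows "orth_dir Q k \<in> Q" "lat k \<bullet> lat (orth_dir Q k) = 0"
    and "v \<in> Q \<Longrightarrow> lat k \<bullet> lat v = 0 \<Longrightarrow> v = orth_dir Q k"
  using theI'[OF orthogonal_direction[OF assms]] orthogonal_direction[OF assms]
  unfolding orth_dir_def by blast+

lemma orth_dir_graph:
  assumes "direction_set Q" "k \<noteq> 0" "v \<in> Q" "(k, v) \<notin> (\<lambda>k. (k, orth_dir Q k)) ` (- {0})"
  shows "lat k \<bullet> lat v \<noteq> 0"
  using orth_dir(3)[OF assms(1,2,3)] assms(2,4) by auto

lemma direction_set_nonempty: "direction_set Q \<Longrightarrow> \<exists>q. q \<in> Q"
  using orth_dir(1)[of Q "(1, 0)"] by (auto simp: zero_prod_def)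

section \<open>The adjoint\<close>

lemma mean_HQ_eq:
  assumes "direction_set Q" "\<And>v. v \<in> Q \<Longrightarrow> fourier (g v) 0 = c"
  shows "mean_HQ Q g = c"
proof -
  obtain q where "q \<in> Q" using direction_set_nonempty[OF assms(1)] by blast
  then show ?thesis unfolding mean_HQ_def by (intro the_equality) (auto simp: assms(2))
qed

lemma fourier_0_eq_mean:
  assumes "direction_set Q" "g \<in> HQ Q \<tau>" "v \<in> Q"
  shows "fourier (g v) 0 = mean_HQ Q g"
proof -
  obtain c where "\<forall>v\<in>Q. fourier (g v) 0 = c" using assms(2) by (auto simp: HQ_def)
  then show ?thesis using mean_HQ_eq[OF assms(1), of g c] assms(3) by auto
qed

text \<open>
  The Fourier coefficients of the adjoint of the X-ray transform applied to \<open>g\<close>: at a nonzero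
  frequency only the direction orthogonal to it contributes.
\<close>

definition adj_coef :: "(int \<times> int) set \<Rightarrow> (int \<times> int \<Rightarrow> functional) \<Rightarrow> int \<times> int \<Rightarrow> complex" where
  "adj_coef Q g k = (if k = 0 then mean_HQ Q g else fourier (g (orth_dir Q k)) k)"

lemma UNIV_insert_0: "(UNIV :: (int \<times> int) set) = insert 0 (- {0})"
  by auto

lemma inj_orth_graph: "inj_on (\<lambda>k. (k, orth_dir Q k)) S"
  by (auto simp: inj_on_def)

text \<open>
  The map sending \<open>k\<close> to \<open>(k, orth_dir Q k)\<close> embeds the nonzero frequencies into the index set of the
  norm of \<open>g\<close>, so the adjoint has norm at most one: its square sum is a part of that of \<open>g\<close>.
\<close>

lemma adj_coef_l2:
  assumes Q: "direction_set Q" and g: "g \<in> HQ Q \<tau>"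
  shows "(\<lambda>k. japanese k powr (2 * \<tau>) * (norm (adj_coef Q g k))\<^sup>2) summable_on UNIV" (is "?F summable_on _")
    and "(\<Sum>\<^sub>\<infinity>k. japanese k powr (2 * \<tau>) * (norm (adj_coef Q g k))\<^sup>2) \<le> (HQ_norm Q \<tau> g)\<^sup>2"
proof -
  let ?G = "\<lambda>(k, v). japanese k powr (2 * \<tau>) * (norm (fourier (g v) k))\<^sup>2"
  let ?i = "\<lambda>k. (k, orth_dir Q k)"
  have G: "?G summable_on (- {0}) \<times> Q" using g by (simp add: HQ_def)
  have sub: "?i ` (- {0}) \<subseteq> (- {0}) \<times> Q" using orth_dir(1)[OF Q] by auto
  have G': "?G summable_on ?i ` (- {0})" using summable_on_subset[OF G sub] .
  then have "(?G \<circ> ?i) summable_on (- {0})"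
    by (subst (asm) summable_on_reindex[OF inj_orth_graph])
  also have "?this \<longleftrightarrow> ?F summable_on (- {0})"
    by (rule summable_on_cong) (simp add: adj_coef_def)
  finally have F: "?F summable_on (- {0})" .
  then show "?F summable_on UNIV"
    unfolding UNIV_insert_0 by (simp only: summable_on_insert_iff)
  have "infsum ?F UNIV = ?F 0 + infsum ?F (- {0})"
    unfolding UNIV_insert_0 by (rule infsum_insert[OF F]) simp
  also have "infsum ?F (- {0}) = infsum (?G \<circ> ?i) (- {0})"
    by (rule infsum_cong) (simp add: adj_coef_def)
  also have "\<dots> = infsum ?G (?i ` (- {0}))"
    by (rule infsum_reindex[OF inj_orth_graph, symmetric])
  also have "?F 0 + infsum ?G (?i ` (- {0})) \<le> ?F 0 + infsum ?G ((- {0}) \<times> Q)"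
    by (intro add_left_mono infsum_mono2 G G' sub) auto
  also have "\<dots> = (HQ_norm Q \<tau> g)\<^sup>2"
    unfolding HQ_norm_def
    by (subst real_sqrt_pow2) (auto simp: adj_coef_def intro!: add_nonneg_nonneg infsum_nonneg)
  finally show "infsum ?F UNIV \<le> (HQ_norm Q \<tau> g)\<^sup>2" .
qed

text \<open>
  The coefficient of the transform of \<open>f\<close> at \<open>(k, v)\<close> with \<open>k \<noteq> 0\<close>
  vanishes off the graph of \<^const>\<open>orth_dir\<close>, so the double
  sum collapses to a sum over frequencies.
\<close>

lemma HQ_inner_xray:
  assumes Q: "direction_set Q" and g: "g \<in> HQ Q \<tau>" and f: "f \<in> H \<tau>"
  shows "HQ_inner Q \<tau> (xray f) g =
    (\<Sum>\<^sub>\<infinity>k. of_real (japanese k powr (2 * \<tau>)) * fourier f k * cnj (adj_coef Q g k))"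
proof -
  let ?w = "\<lambda>k. of_real (japanese k powr (2 * \<tau>)) :: complex"
  let ?G = "\<lambda>(k, v). ?w k * fourier (xray f v) k * cnj (fourier (g v) k)"
  let ?F = "\<lambda>k. ?w k * fourier f k * cnj (adj_coef Q g k)"
  let ?i = "\<lambda>k. (k, orth_dir Q k)"
  note fd = H_distribution[OF f]
  have mean: "mean_HQ Q (xray f) = fourier f 0"
    by (rule mean_HQ_eq[OF Q]) (simp add: fourier_xray[OF fd])
  have off_graph: "?G p = 0" if "p \<in> (- {0}) \<times> Q - ?i ` (- {0})" for p
    using that orth_dir_graph[OF Q, of "fst p" "snd p"] by (simp add: mem_Times_iff fourier_xray[OF fd] split_beta)
  have "infsum ?G ((- {0}) \<times> Q) = infsum ?G (?i ` (- {0}))"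
    using orth_dir(1)[OF Q] by (intro infsum_cong_neutral off_graph) auto
  also have "\<dots> = infsum (?G \<circ> ?i) (- {0})"
    by (rule infsum_reindex[OF inj_orth_graph])
  also have "\<dots> = infsum ?F (- {0})"
    using orth_dir[OF Q] by (intro infsum_cong) (auto simp: fourier_xray[OF fd] adj_coef_def)
  finally have "HQ_inner Q \<tau> (xray f) g = ?F 0 + infsum ?F (- {0})"
    by (simp add: HQ_inner_def mean adj_coef_def)
  also have "\<dots> = infsum ?F UNIV"
    unfolding UNIV_insert_0
    by (rule infsum_insert[symmetric])
      (use f adj_coef_l2(1)[OF Q g] in \<open>auto simp: H_def intro: summable_weighted_product\<close>)
  finally show ?thesis .
qed

text \<open>
  The distribution with coefficients \<^const>\<open>adj_coef\<close> satisfies the defining property of the adjoint, so a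
  choice exists.  Conversely, testing the adjoint identity with a single character reads off the
  coefficient of any admissible choice, for whichever exponent \<open>\<sigma>\<close> it was made.
\<close>

lemma xray_adjoint:
  assumes Q: "direction_set Q" and g: "g \<in> HQ Q \<tau>"
  shows "xray_adjoint Q g \<in> H \<tau>" and "fourier (xray_adjoint Q g) k = adj_coef Q g k"
proof -
  let ?P = "\<lambda>h. \<exists>\<tau>. g \<in> HQ Q \<tau> \<and> h \<in> H \<tau> \<and> (\<forall>f\<in>H \<tau>. HQ_inner Q \<tau> (xray f) g = H_inner \<tau> f h)"
  obtain h where h: "h \<in> H \<tau>" "\<And>k. fourier h k = adj_coef Q g k"
    using H_with_fourier[OF adj_coef_l2(1)[OF Q g]] by blast
  have "?P h"
    using g h HQ_inner_xray[OF Q g] by (auto simp: H_inner_def)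
  \<comment> \<open>The choice may be made for an exponent other than \<open>\<tau>\<close>.\<close>
  then have "?P (xray_adjoint Q g)"
    unfolding xray_adjoint_def by (rule someI[of ?P])
  then obtain \<sigma> where \<sigma>: "g \<in> HQ Q \<sigma>" "xray_adjoint Q g \<in> H \<sigma>"
    "\<And>f. f \<in> H \<sigma> \<Longrightarrow> HQ_inner Q \<sigma> (xray f) g = H_inner \<sigma> f (xray_adjoint Q g)"
    by blast
  have fourier: "fourier (xray_adjoint Q g) k = adj_coef Q g k" for k
  proof -
    let ?a = "\<lambda>j. if j = k then 1 else 0 :: complex"
    have "(\<lambda>j. japanese j powr (2 * \<sigma>) * (norm (?a j))\<^sup>2) summable_on UNIV"
      by (rule finite_nonzero_values_imp_summable_on) simp
    then obtain e where e: "e \<in> H \<sigma>" "\<And>j. fourier e j = ?a j"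
      using H_with_fourier[where a = ?a] by blast
    have pick: "(\<Sum>\<^sub>\<infinity>j. of_real (japanese j powr (2 * \<sigma>)) * fourier e j * cnj (b j))
        = of_real (japanese k powr (2 * \<sigma>)) * cnj (b k)" for b
    proof -
      have "(\<Sum>\<^sub>\<infinity>j. of_real (japanese j powr (2 * \<sigma>)) * fourier e j * cnj (b j))
        = (\<Sum>\<^sub>\<infinity>j\<in>{k}. of_real (japanese j powr (2 * \<sigma>)) * fourier e j * cnj (b j))"
        by (rule infsum_cong_neutral) (auto simp: e)
      then show ?thesis by (simp add: e)
    qed
    have "of_real (japanese k powr (2 * \<sigma>)) * cnj (adj_coef Q g k)
        = of_real (japanese k powr (2 * \<sigma>)) * cnj (fourier (xray_adjoint Q g) k)"
      using \<sigma>(3)[OF e(1)] unfolding HQ_inner_xray[OF Q \<sigma>(1) e(1)] H_inner_def pick .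
    then show ?thesis using japanese_powr_pos[of k "2 * \<sigma>"] by simp
  qed
  then show "fourier (xray_adjoint Q g) k = adj_coef Q g k" .
  show "xray_adjoint Q g \<in> H \<tau>"
    using adj_coef_l2(1)[OF Q g] H_distribution[OF \<sigma>(2)] by (simp add: H_def fourier)
qed

lemma xray_HQ:
  assumes Q: "direction_set Q" and f: "f \<in> H \<tau>"
  shows "xray f \<in> HQ Q \<tau>"
proof -
  note fd = H_distribution[OF f]
  let ?F = "\<lambda>k. japanese k powr (2 * \<tau>) * (norm (fourier f k))\<^sup>2"
  let ?G = "\<lambda>(k, v). japanese k powr (2 * \<tau>) * (norm (fourier (xray f v) k))\<^sup>2"
  let ?i = "\<lambda>k. (k, orth_dir Q k)"
  have F: "?F summable_on UNIV" using f by (simp add: H_def)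
  have "(\<lambda>k. japanese k powr (2 * \<tau>) * (norm (fourier (xray f v) k))\<^sup>2) summable_on UNIV" for v
    by (rule summable_on_comparison_test[OF F]) (auto simp: fourier_xray[OF fd])
  then have 1: "xray f v \<in> H \<tau>" for v
    using xray_distribution[OF fd] by (simp add: H_def)
  have "?F summable_on (- {0})"
    by (rule summable_on_subset[OF F subset_UNIV])
  also have "?this \<longleftrightarrow> (?G \<circ> ?i) summable_on (- {0})"
    using orth_dir(2)[OF Q] by (intro summable_on_cong) (simp add: fourier_xray[OF fd])
  finally have "?G summable_on ?i ` (- {0})"
    by (subst summable_on_reindex[OF inj_orth_graph])
  moreover have "?G p = 0" if "p \<in> (- {0}) \<times> Q - ?i ` (- {0})" for p
    using that orth_dir_graph[OF Q, of "fst p" "snd p"] by (simp add: mem_Times_iff fourier_xray[OF fd] split_beta)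
  then have "?G summable_on ?i ` (- {0}) \<longleftrightarrow> ?G summable_on (- {0}) \<times> Q"
    using orth_dir(1)[OF Q] by (intro summable_on_cong_neutral) auto
  ultimately have 2: "?G summable_on (- {0}) \<times> Q" by blast
  show ?thesis
    unfolding HQ_def using 1 2 by (auto simp: fourier_xray[OF fd])
qed

lemma HQ_mono:
  assumes "\<sigma> \<le> \<tau>" "g \<in> HQ Q \<tau>"
  shows "g \<in> HQ Q \<sigma>"
proof -
  have "(\<lambda>p. japanese (fst p) powr (2 * \<tau>) * (norm (fourier (g (snd p)) (fst p)))\<^sup>2) summable_on (- {0}) \<times> Q"
    using assms(2) by (simp add: HQ_def case_prod_beta')
  note summable_weight_mono[OF assms(1) this]
  then show ?thesis
    using assms(2) H_mono[OF assms(1)] by (auto simp: HQ_def case_prod_beta')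
qed

lemma HQ_add:
  assumes g: "g \<in> HQ Q \<tau>" and h: "h \<in> HQ Q \<tau>"
  shows "(\<lambda>v \<psi>. g v \<psi> + h v \<psi>) \<in> HQ Q \<tau>"
proof -
  have add: "fourier (\<lambda>\<psi>. g v \<psi> + h v \<psi>) k = fourier (g v) k + fourier (h v) k" for v k
    by (simp add: fourier_def)
  have "(\<lambda>\<psi>. g v \<psi> + h v \<psi>) \<in> H \<tau>" if "v \<in> Q" for v
  proof -
    have *: "g v \<in> H \<tau>" "h v \<in> H \<tau>" using that g h by (auto simp: HQ_def)
    then have "(\<lambda>\<psi>. g v \<psi> + 1 * h v \<psi>) \<in> distributions"
      by (intro distributions_add_mult H_distribution)
    then show ?thesis
      using * by (auto simp: H_def add intro!: summable_weight_add)
  qed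
  moreover have "(\<lambda>p. japanese (fst p) powr (2 * \<tau>) * (norm (fourier (g (snd p)) (fst p) + fourier (h (snd p)) (fst p)))\<^sup>2)
      summable_on (- {0}) \<times> Q"
    by (rule summable_weight_add) (use g h in \<open>simp_all add: HQ_def case_prod_beta'\<close>)
  then have "(\<lambda>(k, v). japanese k powr (2 * \<tau>) * (norm (fourier (\<lambda>\<psi>. g v \<psi> + h v \<psi>) k))\<^sup>2)
      summable_on (- {0}) \<times> Q"
    by (simp add: add case_prod_beta')
  moreover obtain c d where "\<forall>v\<in>Q. fourier (g v) 0 = c" "\<forall>v\<in>Q. fourier (h v) 0 = d"
    using g h by (auto simp: HQ_def)
  then have "\<forall>v\<in>Q. fourier (\<lambda>\<psi>. g v \<psi> + h v \<psi>) 0 = c + d" by (simp add: add)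
  ultimately show ?thesis unfolding HQ_def by blast
qed

section \<open>Square sums and dominated convergence\<close>

text \<open>
  Minkowski's inequality for infinite square sums, obtained from the one for finite sets.
\<close>

lemma l2_triangle:
  fixes u v w :: "'a \<Rightarrow> real"
  assumes u: "(\<lambda>k. (u k)\<^sup>2) summable_on S" and v: "(\<lambda>k. (v k)\<^sup>2) summable_on S"
    and w: "\<And>k. 0 \<le> w k" "\<And>k. w k \<le> u k + v k"
    and nonneg: "\<And>k. 0 \<le> u k" "\<And>k. 0 \<le> v k"
  shows "(\<lambda>k. (w k)\<^sup>2) summable_on S"
    and "sqrt (\<Sum>\<^sub>\<infinity>k\<in>S. (w k)\<^sup>2) \<le> sqrt (\<Sum>\<^sub>\<infinity>k\<in>S. (u k)\<^sup>2) + sqrt (\<Sum>\<^sub>\<infinity>k\<in>S. (v k)\<^sup>2)" (is "_ \<le> ?R")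
proof -
  have "(u k + v k)\<^sup>2 \<le> 2 * (u k)\<^sup>2 + 2 * (v k)\<^sup>2" for k
    using sum_squares_bound[of "u k" "v k"] by (simp add: power2_sum)
  then have "(w k)\<^sup>2 \<le> 2 * (u k)\<^sup>2 + 2 * (v k)\<^sup>2" for k
    using power_mono[OF w(2) w(1), of k 2] order_trans by blast
  then show summ: "(\<lambda>k. (w k)\<^sup>2) summable_on S"
    by (intro summable_on_comparison_test[OF summable_on_add[OF summable_on_cmult_right[OF u] summable_on_cmult_right[OF v]]])
      auto
  have "(\<Sum>\<^sub>\<infinity>k\<in>S. (w k)\<^sup>2) \<le> ?R\<^sup>2"
  proof (rule infsum_le_finite_sums[OF summ])
    fix F assume F: "finite F" "F \<subseteq> S"
    have "L2_set w F \<le> L2_set (\<lambda>k. u k + v k) F"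
      by (rule L2_set_mono) (use w in auto)
    also have "\<dots> \<le> L2_set u F + L2_set v F" by (rule L2_set_triangle_ineq)
    also have "\<dots> \<le> ?R"
      unfolding L2_set_def
      by (intro add_mono real_sqrt_le_mono finite_sum_le_infsum u v F) auto
    finally have "(L2_set w F)\<^sup>2 \<le> ?R\<^sup>2"
      by (intro power_mono) auto
    then show "(\<Sum>k\<in>F. (w k)\<^sup>2) \<le> ?R\<^sup>2"
      by (simp add: L2_set_def sum_nonneg)
  qed
  moreover have "0 \<le> ?R" by (intro add_nonneg_nonneg) (auto intro: infsum_nonneg)
  ultimately show "sqrt (\<Sum>\<^sub>\<infinity>k\<in>S. (w k)\<^sup>2) \<le> ?R"
    by (intro real_le_lsqrt)
qed

text \<open>
  Dominated convergence for unordered sums: outside a finite set the majorant has arbitrarily small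
  sum, and inside it there are finitely many limits.
\<close>

lemma infsum_dominated_tendsto_0:
  fixes F :: "'a \<Rightarrow> 'b \<Rightarrow> real"
  assumes w: "w summable_on S"
    and dom: "\<forall>\<^sub>F x in L. \<forall>k\<in>S. 0 \<le> F k x \<and> F k x \<le> w k"
    and lim: "\<And>k. k \<in> S \<Longrightarrow> (F k \<longlongrightarrow> 0) L"
  shows "((\<lambda>x. \<Sum>\<^sub>\<infinity>k\<in>S. F k x) \<longlongrightarrow> 0) L"
proof (rule tendstoI)
  fix e :: real assume "e > 0"
  obtain X where X: "finite X" "X \<subseteq> S" "dist (sum w X) (infsum w S) \<le> e / 3"
    using infsum_finite_approximation[OF w, of "e / 3"] \<open>e > 0\<close> by auto
  have wS: "w summable_on (S - X)" using summable_on_subset[OF w] by blast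
  have "infsum w S = sum w X + infsum w (S - X)"
    using infsum_Un_disjoint[of w X "S - X"] wS X by (simp add: Un_absorb1)
  then have tail: "infsum w (S - X) \<le> e / 3"
    using X(3) by (simp add: dist_real_def)
  have "((\<lambda>x. \<Sum>k\<in>X. F k x) \<longlongrightarrow> 0) L"
    using lim X(2) by (intro tendsto_null_sum) auto
  then have "\<forall>\<^sub>F x in L. dist (\<Sum>k\<in>X. F k x) 0 < e / 3"
    using \<open>e > 0\<close> by (intro tendstoD) auto
  with dom show "\<forall>\<^sub>F x in L. dist (\<Sum>\<^sub>\<infinity>k\<in>S. F k x) 0 < e"
  proof eventually_elim
    case (elim x)
    have F: "(\<lambda>k. F k x) summable_on (S - X)"
      by (rule summable_on_comparison_test[OF wS]) (use elim in auto)
    have "(\<Sum>\<^sub>\<infinity>k\<in>S. F k x) = (\<Sum>k\<in>X. F k x) + (\<Sum>\<^sub>\<infinity>k\<in>S - X. F k x)"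
      using infsum_Un_disjoint[of "\<lambda>k. F k x" X "S - X"] F X by (simp add: Un_absorb1)
    moreover have "(\<Sum>\<^sub>\<infinity>k\<in>S - X. F k x) \<le> infsum w (S - X)"
      by (rule infsum_mono[OF F wS]) (use elim in auto)
    moreover have "0 \<le> (\<Sum>\<^sub>\<infinity>k\<in>S. F k x)" by (rule infsum_nonneg) (use elim in auto)
    ultimately show ?case using elim tail \<open>e > 0\<close> by (simp add: dist_real_def)
  qed
qed

section \<open>The reconstruction error\<close>

lemma reg_mult:
  assumes h: "h \<in> H \<tau>" and \<alpha>: "\<alpha> > 0"
  shows "reg_mult s \<alpha> h \<in> distributions"
    and "fourier (reg_mult s \<alpha> h) k = of_real (inverse (1 + \<alpha> * japanese k powr (2 * s))) * fourier h k"
proof -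
  let ?a = "\<lambda>k. of_real (inverse (1 + \<alpha> * japanese k powr (2 * s))) * fourier h k"
  have "norm (?a k) \<le> norm (fourier h k)" for k
  proof -
    have "1 \<le> 1 + \<alpha> * japanese k powr (2 * s)" using \<alpha> by simp
    then have "\<bar>inverse (1 + \<alpha> * japanese k powr (2 * s))\<bar> \<le> 1"
      by (simp add: inverse_le_1_iff)
    then have "\<bar>inverse (1 + \<alpha> * japanese k powr (2 * s))\<bar> * norm (fourier h k) \<le> 1 * norm (fourier h k)"
      by (intro mult_right_mono) auto
    then show ?thesis by (simp only: norm_mult norm_of_real mult_1)
  qed
  moreover obtain A where "\<And>k. norm (fourier h k) \<le> A * japanese k powr (- \<tau>)"
    using h weighted_l2_bounded[of \<tau> "fourier h"] by (auto simp: H_def)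
  ultimately have "norm (?a k) \<le> A * japanese k powr (- \<tau>)" for k
    using order_trans by blast
  then obtain u where "u \<in> distributions" "\<And>k. fourier u k = ?a k"
    using distribution_with_fourier[where a = ?a] by blast
  then have "\<exists>u. u \<in> distributions \<and> (\<forall>k. fourier u k = ?a k)" by blast
  from someI_ex[OF this, folded reg_mult_def]
  show "reg_mult s \<alpha> h \<in> distributions" "fourier (reg_mult s \<alpha> h) k = ?a k" by auto
qed

text \<open>
  The adjoint inverts the transform on the level of Fourier coefficients, because the coefficient of
  the transform of \<open>f\<close> at the direction orthogonal to \<open>k\<close> is that of \<open>f\<close>.  The data live in a
  common space whose exponent is the smaller of the exponents of the signal and of the noise.
\<close>

lemma recon_error:
  assumes Q: "direction_set Q" and f: "f \<in> H \<sigma>" and g: "g \<in> HQ Q \<tau>" and \<alpha>: "\<alpha> > 0"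
  shows "recon_error Q s \<alpha> f g \<in> distributions"
    and "fourier (recon_error Q s \<alpha> f g) k =
      of_real (inverse (1 + \<alpha> * japanese k powr (2 * s))) * (fourier f k + adj_coef Q g k) - fourier f k"
proof -
  let ?g = "\<lambda>v \<psi>. xray f v \<psi> + g v \<psi>"
  let ?\<rho> = "min \<sigma> \<tau>"
  note fd = H_distribution[OF f]
  have data: "?g \<in> HQ Q ?\<rho>"
    by (intro HQ_add HQ_mono[OF min.cobounded1 xray_HQ[OF Q f]] HQ_mono[OF min.cobounded2 g])
  have add: "fourier (?g v) k = fourier (xray f v) k + fourier (g v) k" for v k
    by (simp add: fourier_def)
  have "adj_coef Q ?g k = fourier f k + adj_coef Q g k" for k
  proof (cases "k = 0")
    case True
    have "mean_HQ Q ?g = fourier f 0 + mean_HQ Q g"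
      by (rule mean_HQ_eq[OF Q]) (simp add: add fourier_xray[OF fd] fourier_0_eq_mean[OF Q g])
    then show ?thesis by (simp add: adj_coef_def True)
  next
    case False
    then show ?thesis
      by (simp add: adj_coef_def add fourier_xray[OF fd] orth_dir(2)[OF Q])
  qed
  note adj = xray_adjoint[OF Q data, unfolded this]
  note reg = reg_mult[OF adj(1) \<alpha>, of s, unfolded adj(2)]
  have eq: "recon_error Q s \<alpha> f g = (\<lambda>\<phi>. reg_mult s \<alpha> (xray_adjoint Q ?g) \<phi> + (- 1) * f \<phi>)"
    by (simp add: recon_error_def)
  show "recon_error Q s \<alpha> f g \<in> distributions"
    unfolding eq by (rule distributions_add_mult[OF reg(1) fd])
  show "fourier (recon_error Q s \<alpha> f g) k =
      of_real (inverse (1 + \<alpha> * japanese k powr (2 * s))) * (fourier f k + adj_coef Q g k) - fourier f k"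
    unfolding eq fourier_add_mult reg(2) by simp
qed

text \<open>
  The complement \<open>1 - 1 / (1 + \<alpha> \<langle>k\<rangle>\<^bsup>2s\<^esup>)\<close> of the regularizing symbol: the relative error that the
  regularization makes at frequency \<open>k\<close> in the absence of noise.  The Sobolev norm of the resulting
  error is called the bias.
\<close>

definition bias_symbol :: "real \<Rightarrow> real \<Rightarrow> int \<times> int \<Rightarrow> real" where
  "bias_symbol s \<alpha> k = \<alpha> * japanese k powr (2 * s) / (1 + \<alpha> * japanese k powr (2 * s))"

definition bias :: "real \<Rightarrow> real \<Rightarrow> real \<Rightarrow> functional \<Rightarrow> real" where
  "bias r s \<alpha> f = sqrt (\<Sum>\<^sub>\<infinity>k. (bias_symbol s \<alpha> k * japanese k powr r * norm (fourier f k))\<^sup>2)"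

lemma bias_symbol_bounds:
  assumes "\<alpha> > 0"
  shows "0 \<le> bias_symbol s \<alpha> k" "bias_symbol s \<alpha> k \<le> 1"
proof -
  have "0 \<le> \<alpha> * japanese k powr (2 * s)" using assms by simp
  then show "0 \<le> bias_symbol s \<alpha> k" "bias_symbol s \<alpha> k \<le> 1"
    by (simp_all add: bias_symbol_def divide_le_eq_1)
qed

lemma bias_summable:
  assumes "f \<in> H r" "\<alpha> > 0"
  shows "(\<lambda>k. (bias_symbol s \<alpha> k * japanese k powr r * norm (fourier f k))\<^sup>2) summable_on UNIV"
    and "(bias_symbol s \<alpha> k * japanese k powr r * norm (fourier f k))\<^sup>2
      \<le> japanese k powr (2 * r) * (norm (fourier f k))\<^sup>2"
proof -
  have *: "(bias_symbol s \<alpha> k * japanese k powr r * norm (fourier f k))\<^sup>2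
      \<le> japanese k powr (2 * r) * (norm (fourier f k))\<^sup>2" for k
    unfolding weight_sq mult.assoc
    using bias_symbol_bounds[OF assms(2), of s k] by (intro power_mono mult_left_le_one_le mult_nonneg_nonneg) auto
  then show "(bias_symbol s \<alpha> k * japanese k powr r * norm (fourier f k))\<^sup>2
      \<le> japanese k powr (2 * r) * (norm (fourier f k))\<^sup>2" .
  show "(\<lambda>k. (bias_symbol s \<alpha> k * japanese k powr r * norm (fourier f k))\<^sup>2) summable_on UNIV"
    by (rule summable_on_comparison_test[OF _ *]) (use assms(1) in \<open>auto simp: H_def\<close>)
qed

text \<open>
  The error splits into bias and filtered noise.  The filter is at most \<open>\<langle>k\<rangle>\<^bsup>-2s\<^esup> / \<alpha>\<close>, and the \<open>2 s\<close>
  derivatives that it gains bring the noise from \<open>H t\<close> to \<open>H r\<close>, as \<open>r \<le> 2 s + t\<close>.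
\<close>

lemma recon_error_bound:
  assumes Q: "direction_set Q" and f: "f \<in> H r" and g: "g \<in> HQ Q t" and \<alpha>: "\<alpha> > 0"
    and rt: "r \<le> 2 * s + t"
  shows "recon_error Q s \<alpha> f g \<in> H r"
    and "H_norm r (recon_error Q s \<alpha> f g) \<le> bias r s \<alpha> f + HQ_norm Q t g / \<alpha>"
proof -
  let ?e = "\<lambda>k. fourier (recon_error Q s \<alpha> f g) k"
  define u where "u = (\<lambda>k. bias_symbol s \<alpha> k * japanese k powr r * norm (fourier f k))"
  define v where "v = (\<lambda>k. inverse \<alpha> * (japanese k powr t * norm (adj_coef Q g k)))"
  define w where "w = (\<lambda>k. japanese k powr r * norm (?e k))"
  have u: "(\<lambda>k. (u k)\<^sup>2) summable_on UNIV"
    unfolding u_def by (rule bias_summable(1)[OF f \<alpha>])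
  have v_eq: "(v k)\<^sup>2 = (inverse \<alpha>)\<^sup>2 * (japanese k powr (2 * t) * (norm (adj_coef Q g k))\<^sup>2)" for k
    by (simp add: v_def weight_sq power_mult_distrib)
  note adj = adj_coef_l2[OF Q g]
  have v: "(\<lambda>k. (v k)\<^sup>2) summable_on UNIV"
    unfolding v_eq by (rule summable_on_cmult_right[OF adj(1)])
  have "(\<Sum>\<^sub>\<infinity>k. (v k)\<^sup>2) = (inverse \<alpha>)\<^sup>2 * (\<Sum>\<^sub>\<infinity>k. japanese k powr (2 * t) * (norm (adj_coef Q g k))\<^sup>2)"
    unfolding v_eq by (rule infsum_cmult_right) (rule adj(1))
  also have "\<dots> \<le> (inverse \<alpha>)\<^sup>2 * (HQ_norm Q t g)\<^sup>2"
    by (intro mult_left_mono adj(2)) simp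
  also have "\<dots> = (HQ_norm Q t g / \<alpha>)\<^sup>2"
    by (simp add: power_mult_distrib[symmetric] field_simps)
  finally have v_norm: "sqrt (\<Sum>\<^sub>\<infinity>k. (v k)\<^sup>2) \<le> HQ_norm Q t g / \<alpha>"
    using \<alpha> by (intro real_le_lsqrt) (auto simp: HQ_norm_def intro!: divide_nonneg_nonneg add_nonneg_nonneg infsum_nonneg)
  have wuv: "w k \<le> u k + v k" for k
  proof -
    define J where "J = japanese k powr (2 * s)"
    have J: "J > 0" unfolding J_def by (rule japanese_powr_pos)
    have pos: "1 + \<alpha> * J > 0" using \<alpha> J by (simp add: add_pos_pos)
    let ?m = "inverse (1 + \<alpha> * J)"
    have B: "bias_symbol s \<alpha> k = 1 - ?m"
    proof -
      have "bias_symbol s \<alpha> k = \<alpha> * J / (1 + \<alpha> * J)" by (simp only: bias_symbol_def J_def)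
      then show ?thesis using pos by (simp add: field_simps)
    qed
    have "?e k = of_real ?m * adj_coef Q g k - of_real (bias_symbol s \<alpha> k) * fourier f k"
      unfolding recon_error(2)[OF Q f g \<alpha>] J_def[symmetric] B by (simp add: algebra_simps)
    then have "norm (?e k) \<le> norm (of_real ?m * adj_coef Q g k) + norm (of_real (bias_symbol s \<alpha> k) * fourier f k)"
      by (simp only: norm_triangle_ineq4)
    also have "\<dots> = ?m * norm (adj_coef Q g k) + bias_symbol s \<alpha> k * norm (fourier f k)"
      using pos bias_symbol_bounds(1)[OF \<alpha>, of s k] by (simp only: norm_mult norm_of_real) simp
    finally have "w k \<le> japanese k powr r * (?m * norm (adj_coef Q g k) + bias_symbol s \<alpha> k * norm (fourier f k))"
      unfolding w_def by (intro mult_left_mono) auto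
    also have "\<dots> = (japanese k powr r * ?m) * norm (adj_coef Q g k) + u k"
      by (simp add: u_def algebra_simps)
    also have "japanese k powr r * ?m \<le> inverse \<alpha> * japanese k powr t"
    proof -
      have "japanese k powr r \<le> J * japanese k powr t"
        unfolding J_def powr_add[symmetric] using rt japanese_ge_1 by (intro powr_mono) auto
      moreover have "J \<le> inverse \<alpha> * (1 + \<alpha> * J)" using \<alpha> by (simp add: field_simps)
      ultimately have "japanese k powr r \<le> inverse \<alpha> * (1 + \<alpha> * J) * japanese k powr t"
        by (meson mult_right_mono order_trans powr_ge_zero)
      then show ?thesis using pos by (simp add: field_simps)
    qed
    then have "(japanese k powr r * ?m) * norm (adj_coef Q g k) + u k
        \<le> (inverse \<alpha> * japanese k powr t) * norm (adj_coef Q g k) + u k"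
      by (intro add_right_mono mult_right_mono) auto
    finally show ?thesis by (simp add: v_def mult.assoc)
  qed
  have nonneg: "0 \<le> u k" "0 \<le> v k" "0 \<le> w k" for k
    using \<alpha> bias_symbol_bounds(1)[OF \<alpha>, of s k] by (auto simp: u_def v_def w_def)
  note tri = l2_triangle[OF u v nonneg(3) wuv nonneg(1,2)]
  show "recon_error Q s \<alpha> f g \<in> H r"
    using recon_error(1)[OF Q f g \<alpha>, of s] tri(1) by (simp add: H_def weight_sq w_def)
  have "H_norm r (recon_error Q s \<alpha> f g) = sqrt (\<Sum>\<^sub>\<infinity>k. (w k)\<^sup>2)"
    by (simp add: H_norm_def weight_sq w_def)
  also have "\<dots> \<le> sqrt (\<Sum>\<^sub>\<infinity>k. (u k)\<^sup>2) + sqrt (\<Sum>\<^sub>\<infinity>k. (v k)\<^sup>2)"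
    by (rule tri(2))
  also have "\<dots> \<le> bias r s \<alpha> f + HQ_norm Q t g / \<alpha>"
    using v_norm by (simp add: bias_def u_def)
  finally show "H_norm r (recon_error Q s \<alpha> f g) \<le> bias r s \<alpha> f + HQ_norm Q t g / \<alpha>" .
qed

text \<open>
  The quotient is largest at \<open>y = 1 / x - 1\<close>, where it equals \<open>C_const x\<close>.  Weighted arithmetic and
  geometric means of \<open>y / (1 / x - 1)\<close> and \<open>1\<close> give the bound without calculus, with equality
  exactly at that point.
\<close>

lemma powr_quotient_le_C_const:
  assumes x: "0 < x" "x < 1" and y: "0 < y"
  shows "y powr (1 - x) / (1 + y) \<le> C_const x"
proof -
  define z where "z = inverse x - 1"
  have z: "z > 0" using x by (simp add: z_def one_less_inverse)
  have xz: "x * z = 1 - x" using x by (simp add: z_def right_diff_distrib)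
  have "(y / z) powr (1 - x) * 1 powr x \<le> (1 - x) * (y / z) + x * 1"
    by (rule Youngs_inequality_0) (use x y z in auto)
  also have "\<dots> = x * (1 + y)"
    unfolding xz[symmetric] using z by (simp add: field_simps)
  finally have "y powr (1 - x) \<le> x * (1 + y) * z powr (1 - x)"
    using y z by (simp add: powr_divide divide_le_eq)
  then show ?thesis
    using y by (simp add: C_const_def z_def[symmetric] divide_le_eq mult_ac)
qed

text \<open>
  With \<open>y = \<alpha> \<langle>k\<rangle>\<^bsup>2s\<^esup>\<close> and \<open>x = \<delta> / (2 s)\<close> the symbol is \<open>y / (1 + y)\<close>, and splitting off
  \<open>y powr x = \<alpha> powr x * \<langle>k\<rangle>\<^bsup>\<delta>\<^esup>\<close> leaves the quotient of
  \<open>powr_quotient_le_C_const\<close>.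
\<close>

lemma bias_symbol_le:
  assumes "0 < \<delta>" "\<delta> < 2 * s" "0 < \<alpha>"
  shows "bias_symbol s \<alpha> k \<le> \<alpha> powr (\<delta> / (2 * s)) * C_const (\<delta> / (2 * s)) * japanese k powr \<delta>"
proof -
  define x where "x = \<delta> / (2 * s)"
  define y where "y = \<alpha> * japanese k powr (2 * s)"
  have x: "0 < x" "x < 1" using assms by (auto simp: x_def)
  have y: "y > 0" using assms japanese_powr_pos by (simp add: y_def)
  have "y powr x = \<alpha> powr x * japanese k powr \<delta>"
    using assms by (simp add: y_def powr_mult powr_powr x_def)
  moreover have "bias_symbol s \<alpha> k = y powr x * (y powr (1 - x) / (1 + y))"
    using y by (simp add: bias_symbol_def y_def[symmetric] flip: powr_add)
  moreover have "y powr x * (y powr (1 - x) / (1 + y)) \<le> y powr x * C_const x"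
    by (intro mult_left_mono powr_quotient_le_C_const x y) simp
  ultimately show ?thesis unfolding x_def[symmetric] by (simp only: mult_ac)
qed

lemma bias_le:
  assumes f: "f \<in> H (r + \<delta>)" and \<delta>: "0 < \<delta>" "\<delta> < 2 * s" and \<alpha>: "0 < \<alpha>"
  shows "bias r s \<alpha> f \<le> \<alpha> powr (\<delta> / (2 * s)) * C_const (\<delta> / (2 * s)) * H_norm (r + \<delta>) f"
proof -
  let ?c = "\<alpha> powr (\<delta> / (2 * s)) * C_const (\<delta> / (2 * s))"
  let ?u = "\<lambda>k. (bias_symbol s \<alpha> k * japanese k powr r * norm (fourier f k))\<^sup>2"
  let ?h = "\<lambda>k. japanese k powr (2 * (r + \<delta>)) * (norm (fourier f k))\<^sup>2"
  have fr: "f \<in> H r" using H_mono[OF _ f, of r] \<delta> by simp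
  have h: "?h summable_on UNIV" using f by (simp add: H_def)
  have c0: "0 \<le> ?c" using \<delta> by (simp add: C_const_def)
  have "?u k \<le> ?c\<^sup>2 * ?h k" for k
  proof -
    have "bias_symbol s \<alpha> k * japanese k powr r * norm (fourier f k)
        \<le> (?c * japanese k powr \<delta>) * japanese k powr r * norm (fourier f k)"
      by (intro mult_right_mono bias_symbol_le \<delta> \<alpha>) auto
    also have "\<dots> = ?c * (japanese k powr (r + \<delta>) * norm (fourier f k))"
      by (simp add: powr_add mult_ac)
    finally have "?u k \<le> (?c * (japanese k powr (r + \<delta>) * norm (fourier f k)))\<^sup>2"
      using bias_symbol_bounds(1)[OF \<alpha>, of s k] by (intro power_mono) auto
    then show ?thesis by (simp only: power_mult_distrib weight_sq)
  qed
  then have "infsum ?u UNIV \<le> (\<Sum>\<^sub>\<infinity>k. ?c\<^sup>2 * ?h k)"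
    by (intro infsum_mono bias_summable(1)[OF fr \<alpha>] summable_on_cmult_right[OF h])
  also have "\<dots> = ?c\<^sup>2 * infsum ?h UNIV"
    by (rule infsum_cmult_right) (rule h)
  finally have "bias r s \<alpha> f \<le> sqrt (?c\<^sup>2 * infsum ?h UNIV)"
    unfolding bias_def by (rule real_sqrt_le_mono)
  also have "\<dots> = ?c * H_norm (r + \<delta>) f"
    using c0 by (simp only: real_sqrt_mult real_sqrt_abs abs_of_nonneg H_norm_def)
  finally show ?thesis .
qed

text \<open>
  Mere membership in \<open>H r\<close> gives no rate; but the symbol is at most one and tends to zero at each frequency, so dominated convergence applies.
\<close>

lemma bias_tendsto_0:
  assumes f: "f \<in> H r"
  shows "((\<lambda>\<alpha>. bias r s \<alpha> f) \<longlongrightarrow> 0) (at_right 0)"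
proof -
  let ?w = "\<lambda>k. japanese k powr (2 * r) * (norm (fourier f k))\<^sup>2"
  have "((\<lambda>\<alpha>. \<Sum>\<^sub>\<infinity>k. (bias_symbol s \<alpha> k * japanese k powr r * norm (fourier f k))\<^sup>2) \<longlongrightarrow> 0) (at_right 0)"
  proof (rule infsum_dominated_tendsto_0)
    show "?w summable_on UNIV" using f by (simp add: H_def)
    show "\<forall>\<^sub>F \<alpha> in at_right 0. \<forall>k\<in>UNIV.
        0 \<le> (bias_symbol s \<alpha> k * japanese k powr r * norm (fourier f k))\<^sup>2 \<and>
        (bias_symbol s \<alpha> k * japanese k powr r * norm (fourier f k))\<^sup>2 \<le> ?w k"
      using eventually_at_right_less[of 0]
      by eventually_elim (use bias_summable(2)[OF f] in auto)
    fix k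
    have "((\<lambda>\<alpha>. bias_symbol s \<alpha> k) \<longlongrightarrow> 0 * japanese k powr (2 * s) / (1 + 0 * japanese k powr (2 * s))) (at_right 0)"
      unfolding bias_symbol_def by (intro tendsto_intros) auto
    then have "((\<lambda>\<alpha>. bias_symbol s \<alpha> k) \<longlongrightarrow> 0) (at_right 0)" by simp
    from tendsto_power[OF tendsto_mult_left_zero[OF tendsto_mult_left_zero[OF this]], of _ _ 2]
    show "((\<lambda>\<alpha>. (bias_symbol s \<alpha> k * japanese k powr r * norm (fourier f k))\<^sup>2) \<longlongrightarrow> 0) (at_right 0)"
      by simp
  qed
  from tendsto_real_sqrt[OF this] show ?thesis by (simp add: bias_def)
qed

theorem theorem4p8:
  fixes Q :: "(int \<times> int) set" and r t s \<delta> :: real and f :: functional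
  assumes "direction_set Q"
    and "2 * s + t \<ge> r" and "\<delta> \<ge> 0" and "s > 0"
    and "f \<in> H (r + \<delta>)"
  shows "(\<forall>\<alpha>>0. \<forall>g\<in>HQ Q t. recon_error Q s \<alpha> f g \<in> H r) \<and>
    ((\<lambda>\<epsilon>. SUP g\<in>{g \<in> HQ Q t. HQ_norm Q t g \<le> \<epsilon>}.
        ennreal (H_norm r (recon_error Q s (sqrt \<epsilon>) f g))) \<longlongrightarrow> 0) (at_right 0) \<and>
    (\<forall>\<epsilon> \<alpha>. \<forall>g\<in>HQ Q t.
        HQ_norm Q t g \<le> \<epsilon> \<longrightarrow> 0 < \<delta> \<longrightarrow> \<delta> < 2 * s \<longrightarrow> 0 < \<alpha> \<longrightarrow> \<alpha> \<le> 2 * s / \<delta> - 1 \<longrightarrow>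
        H_norm r (recon_error Q s \<alpha> f g)
          \<le> \<alpha> powr (\<delta> / (2 * s)) * C_const (\<delta> / (2 * s)) * H_norm (r + \<delta>) f + \<epsilon> / \<alpha>)"
proof (intro conjI)
  have f: "f \<in> H r" using H_mono[OF _ assms(5), of r] assms(3) by simp
  note bound = recon_error_bound[OF assms(1) f _ _ assms(2)]
  show "\<forall>\<alpha>>0. \<forall>g\<in>HQ Q t. recon_error Q s \<alpha> f g \<in> H r"
    using bound(1) by blast
  show "\<forall>\<epsilon> \<alpha>. \<forall>g\<in>HQ Q t.
        HQ_norm Q t g \<le> \<epsilon> \<longrightarrow> 0 < \<delta> \<longrightarrow> \<delta> < 2 * s \<longrightarrow> 0 < \<alpha> \<longrightarrow> \<alpha> \<le> 2 * s / \<delta> - 1 \<longrightarrow>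
        H_norm r (recon_error Q s \<alpha> f g)
          \<le> \<alpha> powr (\<delta> / (2 * s)) * C_const (\<delta> / (2 * s)) * H_norm (r + \<delta>) f + \<epsilon> / \<alpha>"
  proof (intro allI ballI impI)
    fix \<epsilon> \<alpha> :: real and g
    assume g: "g \<in> HQ Q t" and le: "HQ_norm Q t g \<le> \<epsilon>" and \<delta>: "0 < \<delta>" "\<delta> < 2 * s" and \<alpha>: "0 < \<alpha>"
    show "H_norm r (recon_error Q s \<alpha> f g)
          \<le> \<alpha> powr (\<delta> / (2 * s)) * C_const (\<delta> / (2 * s)) * H_norm (r + \<delta>) f + \<epsilon> / \<alpha>"
      using bound(2)[OF g \<alpha>] bias_le[OF assms(5) \<delta> \<alpha>] divide_right_mono[OF le, of \<alpha>] \<alpha> by linarith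
  qed
  have "filterlim sqrt (at_right 0) (at_right (0::real))"
    unfolding filterlim_at
    using tendsto_real_sqrt[OF tendsto_ident_at, of 0 "{0<..}"] eventually_at_right_less[of "0::real"]
    by (auto elim: eventually_mono)
  from filterlim_compose[OF bias_tendsto_0[OF f] this]
  have "((\<lambda>\<epsilon>. bias r s (sqrt \<epsilon>) f + sqrt \<epsilon>) \<longlongrightarrow> 0 + sqrt 0) (at_right 0)"
    by (intro tendsto_add tendsto_real_sqrt tendsto_ident_at)
  then have upper: "((\<lambda>\<epsilon>. ennreal (bias r s (sqrt \<epsilon>) f + sqrt \<epsilon>)) \<longlongrightarrow> 0) (at_right 0)"
    using tendsto_ennrealI by fastforce
  have "\<forall>\<^sub>F \<epsilon> in at_right 0. (SUP g\<in>{g \<in> HQ Q t. HQ_norm Q t g \<le> \<epsilon>}.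
        ennreal (H_norm r (recon_error Q s (sqrt \<epsilon>) f g))) \<le> ennreal (bias r s (sqrt \<epsilon>) f + sqrt \<epsilon>)"
    using eventually_at_right_less[of "0::real"]
  proof eventually_elim
    case (elim \<epsilon>)
    show ?case
    proof (rule SUP_least)
      fix g assume "g \<in> {g \<in> HQ Q t. HQ_norm Q t g \<le> \<epsilon>}"
      then have g: "g \<in> HQ Q t" and le: "HQ_norm Q t g \<le> \<epsilon>" by auto
      \<comment> \<open>With \<open>\<alpha> = sqrt \<epsilon>\<close> the noise contributes \<open>\<epsilon> / \<alpha> = sqrt \<epsilon>\<close>, uniformly in \<open>g\<close>.\<close>
      have "HQ_norm Q t g / sqrt \<epsilon> \<le> \<epsilon> / sqrt \<epsilon>"
        using elim le by (intro divide_right_mono) auto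
      also have "\<dots> = sqrt \<epsilon>" using elim by (simp add: real_div_sqrt)
      finally show "ennreal (H_norm r (recon_error Q s (sqrt \<epsilon>) f g))
          \<le> ennreal (bias r s (sqrt \<epsilon>) f + sqrt \<epsilon>)"
        using bound(2)[OF g, of "sqrt \<epsilon>"] elim by (intro ennreal_leI) auto
    qed
  qed
  then show "((\<lambda>\<epsilon>. SUP g\<in>{g \<in> HQ Q t. HQ_norm Q t g \<le> \<epsilon>}.
        ennreal (H_norm r (recon_error Q s (sqrt \<epsilon>) f g))) \<longlongrightarrow> 0) (at_right 0)"
    by (intro tendsto_sandwich[OF always_eventually _ tendsto_const upper]) auto
qed

end
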